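(* (1) If, when the reduction algorithm is run on a real Descartes quadruple with positive sum of entries, it ever encounters (in its current quadruple) some element $a<0$, then it will halt at a root quadruple in finitely many more steps. (2) If the input $(a,b,c,d)$ to the reduction algorithm consists of integers, then the reduction algorithm will halt at a root quadruple in finitely many steps. (3) A root quadruple of an Apollonian circle packing is unique if it exists (that is, any two root quadruples occurring as curvature quadruples of Descartes configurations in the same Apollonian circle packing are equal). However, an Apollonian circle packing may contain more than one Descartes configuration yielding this quadruple (that is, there exist packings containing more than one such configuration).
   Context: A real Descartes quadruple is $(a,b,c,d)\in\mathbb R^4$ with $2(a^2+b^2+c^2+d^2)=(a+b+c+d)^2$. For $1\le i\le 4$, let $S_i$ be the $4\times4$ integer matrix that sends a column vector $(v_1,v_2,v_3,v_4)^T$ to the vector with $v_i$ replaced by $2\sum_{j\ne i}v_j-v_i$ and the other entries unchanged; $S_i$ maps Descartes quadruples to Descartes quadruples. A Descartes quadruple $(a,b,c,d)$ with $a+b+c+d>0$ is a root quadruple if $a\le 0\le b\le c\le d$ and $a+b+c\ge d$. Reduction algorithm. Input: a real Descartes quadruple $(a,b,c,d)$ with $a+b+c+d>0$. (Step 1) Test in order $1\le i\le4$ whether some $S_i$ decreases the sum of the entries of the current quadruple. If so, apply it to produce a new quadruple and continue. (Step 2) If no $S_i$ decreases the sum, order the elements of the quadruple in increasing order and halt. A Descartes configuration is a set of four mutually tangent circles (straight lines allowed, with curvature $0$) with disjoint interiors; an enclosing circle has its exterior as "interior" and is given negative curvature. The curvatures of a Descartes configuration form a Descartes quadruple (as an unordered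 quadruple). An Apollonian circle packing is a packing of circles constructed from an initial Descartes configuration by repeatedly filling the interstices between mutually tangent circles with further tangent circles. If the initial configuration has curvature vector $\mathbf v$, the curvature quadruples of the Descartes configurations in the packing are, up to ordering, the vectors $M\mathbf v$ with $M$ in the group generated by $S_1,S_2,S_3,S_4$. *)

theory Defs
  imports "HOL-Analysis.Analysis"
begin

definition entry_sum :: "real^4 \<Rightarrow> real" where
  "entry_sum v = (\<Sum>i\<in>UNIV. v $ i)"

definition descartes_quadruple :: "real^4 \<Rightarrow> bool" where
  "descartes_quadruple v \<longleftrightarrow> 2 * (\<Sum>i\<in>UNIV. (v $ i)\<^sup>2) = (entry_sum v)\<^sup>2"

definition root_quadruple :: "real^4 \<Rightarrow> bool" where
  "root_quadruple v \<longleftrightarrow>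
     descartes_quadruple v \<and> entry_sum v > 0 \<and>
     v $ 1 \<le> 0 \<and> 0 \<le> v $ 2 \<and> v $ 2 \<le> v $ 3 \<and> v $ 3 \<le> v $ 4 \<and>
     v $ 1 + v $ 2 + v $ 3 \<ge> v $ 4"

definition S :: "4 \<Rightarrow> real^4^4" where
  "S i = (\<chi> j k. if j = i then (if k = i then -1 else 2) else (if k = j then 1 else 0))"

lemma S_mult_vector:
  "(S i *v v) $ j = (if j = i then 2 * (\<Sum>k\<in>UNIV - {i}. v $ k) - v $ i else v $ j)"
proof (cases "j = i")
  case True
  have "(S i *v v) $ i = (\<Sum>k\<in>UNIV. (if k = i then -1 else 2) * v $ k)"
    by (simp add: S_def matrix_vector_mult_def)
  also have "\<dots> = - v $ i + (\<Sum>k\<in>UNIV - {i}. (if k = i then -1 else 2) * v $ k)"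
    by (subst sum.remove[of UNIV i]) auto
  also have "(\<Sum>k\<in>UNIV - {i}. (if k = i then -1 else 2) * v $ k) = 2 * (\<Sum>k\<in>UNIV - {i}. v $ k)"
    unfolding sum_distrib_left by (rule sum.cong) auto
  finally show ?thesis using True by simp
next
  case False
  then show ?thesis
    by (simp add: S_def matrix_vector_mult_def if_distrib[of "\<lambda>x. x * _"] cong: if_cong)
qed


section \<open>The reduction algorithm\<close>

datatype reduction_state = Current "real^4" | Halted "real^4"

definition sort_quadruple :: "real^4 \<Rightarrow> real^4" where
  "sort_quadruple v = vector (sort [v $ 1, v $ 2, v $ 3, v $ 4])"

lemma vector_4:
  "(vector [a, b, c, d] :: 'a::zero^4) $ 1 = a"
  "(vector [a, b, c, d] :: 'a^4) $ 2 = b"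
  "(vector [a, b, c, d] :: 'a^4) $ 3 = c"
  "(vector [a, b, c, d] :: 'a^4) $ 4 = d"
  unfolding vector_def by simp_all

text \<open>The order of the tests is the explicit list, not the order of the index type: in type
  \<^typ>\<open>4\<close> the numeral 4 is equal to 0.\<close>

fun reduction_step :: "reduction_state \<Rightarrow> reduction_state" where
  "reduction_step (Current v) =
     (case find (\<lambda>i. entry_sum (S i *v v) < entry_sum v) [1, 2, 3, 4] of
        Some i \<Rightarrow> Current (S i *v v)
      | None \<Rightarrow> Halted (sort_quadruple v))"
| "reduction_step (Halted v) = Halted v"

definition reduction :: "real^4 \<Rightarrow> nat \<Rightarrow> reduction_state" where
  "reduction v n = (reduction_step ^^ n) (Current v)"


section \<open>Descartes configurations and Apollonian circle packings\<close>

text \<open>Circles and straight lines with a chosen interior. In \<open>Circle c r\<close> the radius is signed: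
  if it is negative, the interior is the exterior of the circle. In \<open>Line u t\<close> the
  vector \<open>u\<close> is the unit normal pointing into the interior half-plane. Subject to
  \<open>proper_circle\<close>, the representation is unique, so that equality of these objects is equality
  of oriented circles.\<close>

datatype oriented_circle = Circle complex real | Line complex real

fun proper_circle :: "oriented_circle \<Rightarrow> bool" where
  "proper_circle (Circle c r) \<longleftrightarrow> r \<noteq> 0"
| "proper_circle (Line u t) \<longleftrightarrow> norm u = 1"

fun curvature :: "oriented_circle \<Rightarrow> real" where
  "curvature (Circle c r) = 1 / r"
| "curvature (Line u t) = 0"

fun circle_interior :: "oriented_circle \<Rightarrow> complex set" where
  "circle_interior (Circle c r) = (if r > 0 then ball c r else - cball c \<bar>r\<bar>)"
| "circle_interior (Line u t) = {z. inner u z > t}"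

text \<open>Point sets in the extended plane; \<^const>\<open>None\<close> is the point at infinity. Parallel lines
  are tangent there.\<close>

fun circle_points :: "oriented_circle \<Rightarrow> complex option set" where
  "circle_points (Circle c r) = Some ` sphere c \<bar>r\<bar>"
| "circle_points (Line u t) = insert None (Some ` {z. inner u z = t})"

definition tangent :: "oriented_circle \<Rightarrow> oriented_circle \<Rightarrow> bool" where
  "tangent X Y \<longleftrightarrow> (\<exists>!p. p \<in> circle_points X \<inter> circle_points Y)"

definition descartes_configuration :: "oriented_circle set \<Rightarrow> bool" where
  "descartes_configuration K \<longleftrightarrow>
     card K = 4 \<and> (\<forall>X\<in>K. proper_circle X) \<and>
     pairwise (\<lambda>X Y. tangent X Y \<and> circle_interior X \<inter> circle_interior Y = {}) K"

definition curvature_quadruple :: "oriented_circle set \<Rightarrow> real^4 \<Rightarrow> bool" where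
  "curvature_quadruple K v \<longleftrightarrow> (\<exists>X. bij_betw X UNIV K \<and> v = (\<chi> i. curvature (X i)))"

text \<open>A circle fills an interstice of three mutually tangent circles with disjoint interiors
  iff it is tangent to all three and its interior is disjoint from theirs, that is, iff the
  four circles form a Descartes configuration. Each such triple has two interstices;
  if one already contains a circle of the packing tangent to all three, filling it again adds
  nothing.\<close>

inductive_set packing_from :: "oriented_circle set \<Rightarrow> oriented_circle set"
  for K :: "oriented_circle set" where
  initial: "X \<in> K \<Longrightarrow> X \<in> packing_from K"
| fill: "\<lbrakk>A \<in> packing_from K; B \<in> packing_from K; C \<in> packing_from K;
          descartes_configuration {A, B, C, D}\<rbrakk> \<Longrightarrow> D \<in> packing_from K"

definition apollonian_packing :: "oriented_circle set \<Rightarrow> bool" where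
  "apollonian_packing P \<longleftrightarrow> (\<exists>K. descartes_configuration K \<and> P = packing_from K)"

end

theory Submission
  imports Defs
begin

text \<open>Write \<open>L\<close> for the sum of the entries. An entry is replaced iff it exceeds \<open>L / 2\<close>, and pair
  sums of entries are nonnegative; so the algorithm can only stop at a root quadruple. A negative
  entry stays fixed and bounds the decrease of \<open>L\<close> in all steps but the last from below.

  For uniqueness, represent oriented circles by unit vectors of a Lorentz form such that externally
  tangent circles have product \<open>-1\<close>. Any two distinct circles of a packing have product at
  most \<open>-1\<close>, which is seen by following reduced words in the four inversions. Expanding a circle in
  the basis given by a root configuration then shows that every other circle of the packing has
  curvature at least \<open>L / 2\<close>, hence at least that of each circle of the configuration. So two root
  configurations consist of circles of the same curvatures.\<close>


section \<open>Termination of the reduction algorithm\<close>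

lemma entry_sum_4: "entry_sum v = v $ 1 + v $ 2 + v $ 3 + v $ 4"
  by (simp add: entry_sum_def sum_4)

lemma S_component:
  "(S i *v v) $ j = (if j = i then 2 * entry_sum v - 3 * v $ i else v $ j)"
  by (simp add: S_mult_vector sum_diff1 entry_sum_def)

lemma entry_sum_S: "entry_sum (S i *v v) = 3 * entry_sum v - 4 * v $ i"
  using exhaust_4[of i] by (auto simp: entry_sum_4 S_component)

lemma S_decreases_iff: "entry_sum (S i *v v) < entry_sum v \<longleftrightarrow> entry_sum v / 2 < v $ i"
  by (auto simp: entry_sum_S)

lemma descartes_quadruple_S:
  assumes "descartes_quadruple v"
  shows "descartes_quadruple (S i *v v)"
proof -
  have "2 * ((v $ 1)\<^sup>2 + (v $ 2)\<^sup>2 + (v $ 3)\<^sup>2 + (v $ 4)\<^sup>2) = (entry_sum v)\<^sup>2"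
    using assms by (simp add: descartes_quadruple_def sum_4)
  then show ?thesis
    using exhaust_4[of i]
    unfolding descartes_quadruple_def sum_4 entry_sum_S S_component
    by (auto simp: power2_eq_square algebra_simps)
qed

text \<open>The Descartes equation is equivalent to
  \<open>2 * (a + b) * (c + d) = (a - b)^2 + (c - d)^2\<close>. So complementary pair sums never
  have opposite signs, and their total is positive.\<close>

lemma pair_sum_nonneg_aux:
  fixes a b c d :: real
  assumes "2 * (a\<^sup>2 + b\<^sup>2 + c\<^sup>2 + d\<^sup>2) = (a + b + c + d)\<^sup>2" and "a + b + c + d > 0"
  shows "a + b \<ge> 0"
proof (rule ccontr)
  assume neg: "\<not> a + b \<ge> 0"
  have "2 * ((a + b) * (c + d)) = (a - b)\<^sup>2 + (c - d)\<^sup>2"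
    using assms(1) by (simp add: power2_eq_square algebra_simps)
  then have "(a + b) * (c + d) \<ge> 0"
    by (smt (verit) zero_le_power2)
  then have "c + d \<le> 0"
    using neg by (simp add: zero_le_mult_iff)
  then show False using neg assms(2) by linarith
qed

text \<open>Read as a quadratic equation in \<open>d\<close>, the Descartes equation is
  \<open>(d - (a + b + c))^2 = 4 * (a * b + b * c + c * a)\<close>; the right side is four times the
  difference of the two sides claimed.\<close>

lemma pair_product_ge_aux:
  fixes a b c d :: real
  assumes "2 * (a\<^sup>2 + b\<^sup>2 + c\<^sup>2 + d\<^sup>2) = (a + b + c + d)\<^sup>2"
  shows "a\<^sup>2 \<le> (a + b) * (a + c)"
proof -
  have "4 * ((a + b) * (a + c) - a\<^sup>2) = (d - (a + b + c))\<^sup>2"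
    using assms by (simp add: power2_eq_square algebra_simps)
  then show ?thesis by (smt (verit) zero_le_power2)
qed

lemma pair_sum_nonneg:
  assumes "descartes_quadruple v" and "entry_sum v > 0" and "i \<noteq> j"
  shows "0 \<le> v $ i + v $ j"
  using assms exhaust_4[of i] exhaust_4[of j]
    pair_sum_nonneg_aux[of "v $ 1" "v $ 2" "v $ 3" "v $ 4"]
    pair_sum_nonneg_aux[of "v $ 1" "v $ 3" "v $ 2" "v $ 4"]
    pair_sum_nonneg_aux[of "v $ 1" "v $ 4" "v $ 3" "v $ 2"]
    pair_sum_nonneg_aux[of "v $ 2" "v $ 3" "v $ 1" "v $ 4"]
    pair_sum_nonneg_aux[of "v $ 2" "v $ 4" "v $ 3" "v $ 1"]
    pair_sum_nonneg_aux[of "v $ 3" "v $ 4" "v $ 1" "v $ 2"]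
  by (auto simp: descartes_quadruple_def entry_sum_4 sum_4 add_ac)

text \<open>Some pair of entries away from \<open>i\<close> has positive sum, and \<open>S i\<close>
  keeps that pair. A Descartes quadruple with a positive pair sum has positive total: otherwise the
  total is zero and all entries vanish, or \<open>pair_sum_nonneg\<close> applies to its
  negative.\<close>

lemma entry_sum_S_pos:
  assumes "descartes_quadruple v" and "entry_sum v > 0"
  shows "entry_sum (S i *v v) > 0"
proof -
  let ?w = "S i *v v"
  have d: "descartes_quadruple ?w" by (rule descartes_quadruple_S[OF assms(1)])
  have nonneg: "0 \<le> v $ j + v $ k" if "j \<noteq> k" for j k
    using pair_sum_nonneg[OF assms that] .
  have pos: "entry_sum u > 0"
    if "descartes_quadruple u" "j \<noteq> k" "u $ j + u $ k > 0" for u j k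
  proof (rule ccontr)
    assume L: "\<not> entry_sum u > 0"
    have e: "entry_sum (- u) = - entry_sum u" "descartes_quadruple (- u)"
      using that(1) by (simp_all add: entry_sum_def descartes_quadruple_def sum_negf)
    show False
    proof (cases "entry_sum u = 0")
      case True
      then have "\<forall>m. u $ m = 0"
        using that(1) by (simp add: descartes_quadruple_def sum_nonneg_eq_0_iff)
      then show False using that(3) by simp
    next
      case False
      then show False using pair_sum_nonneg[OF e(2) _ that(2)] e(1) L that(3) by simp
    qed
  qed
  have "\<exists>j k. j \<noteq> k \<and> j \<noteq> i \<and> k \<noteq> i \<and> v $ j + v $ k > 0"
  proof (rule ccontr)
    assume "\<not> ?thesis"
    then have z: "v $ j + v $ k = 0" if "j \<noteq> k" "j \<noteq> i" "k \<noteq> i" for j k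
      using nonneg that by (meson antisym not_less)
    have "v $ j = 0" if "j \<noteq> i" for j
      using z[of 1 2] z[of 1 3] z[of 1 4] z[of 2 3] z[of 2 4] z[of 3 4] that
        exhaust_4[of i] exhaust_4[of j] by auto
    \<comment> \<open>With at most one nonzero entry \<open>x\<close> the equation reads
      \<open>2 * x^2 = x^2\<close>.\<close>
    then have "entry_sum v = v $ i" "(\<Sum>j\<in>UNIV. (v $ j)\<^sup>2) = (v $ i)\<^sup>2"
      unfolding entry_sum_def by (auto simp: sum.remove[of UNIV i])
    then show False using assms by (simp add: descartes_quadruple_def)
  qed
  then obtain j k where "j \<noteq> k" "?w $ j + ?w $ k > 0"
    by (auto simp: S_component)
  with pos[OF d] show ?thesis by blast
qed

lemma root_quadruple_sort:
  assumes d: "descartes_quadruple v" and pos: "entry_sum v > 0"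
    and stop: "\<And>i. v $ i \<le> entry_sum v / 2"
  shows "root_quadruple (sort_quadruple v)"
proof -
  define xs where "xs = [v $ 1, v $ 2, v $ 3, v $ 4]"
  have "length (sort xs) = Suc (Suc (Suc (Suc 0)))" by (simp add: xs_def)
  then obtain a b c e where abce: "sort xs = [a, b, c, e]"
    unfolding length_Suc_conv length_0_conv by blast
  have sq: "sort_quadruple v = vector [a, b, c, e]"
    using abce by (simp add: sort_quadruple_def xs_def)
  have m: "mset xs = mset [a, b, c, e]" using abce mset_sort by metis
  have "sorted [a, b, c, e]" using abce sorted_sort by metis
  then have ord: "a \<le> b" "b \<le> c" "c \<le> e" by auto
  have s1: "entry_sum v = a + b + c + e"
    using arg_cong[OF m, of sum_mset] by (simp add: xs_def entry_sum_4 add_ac)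
  have s2: "(\<Sum>i\<in>UNIV. (v $ i)\<^sup>2) = a\<^sup>2 + b\<^sup>2 + c\<^sup>2 + e\<^sup>2"
    using arg_cong[OF m, of "\<lambda>m. sum_mset (image_mset (\<lambda>x. x\<^sup>2) m)"]
    by (simp add: xs_def sum_4 add_ac)
  have "e \<in> set xs" using abce by (metis set_sort list.set_intros(1,2))
  then have "e \<le> entry_sum v / 2" using stop by (auto simp: xs_def)
  then have le: "e \<le> a + b + c" using s1 by simp
  have D: "2 * (a\<^sup>2 + b\<^sup>2 + c\<^sup>2 + e\<^sup>2) = (a + b + c + e)\<^sup>2"
    using d s1 s2 by (simp add: descartes_quadruple_def)
  have pos': "a + b + c + e > 0" using pos s1 by simp
  have "a \<le> 0"
  proof (rule ccontr)
    assume "\<not> a \<le> 0"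
    then have a: "a > 0" by simp
    \<comment> \<open>Since \<open>c \<le> e \<le> a + b + c\<close>, the base lies between 0 and
      \<open>a + b\<close>. For \<open>0 < a \<le> b \<le> c\<close> this makes the square too
      small, because \<open>a * a \<le> c * a\<close> and \<open>b * b \<le> b * c\<close>.\<close>
    have "(a + b + c - e)\<^sup>2 = 4 * (a * b + b * c + c * a)"
      using D by (simp add: power2_eq_square algebra_simps)
    moreover have "(a + b + c - e)\<^sup>2 \<le> (a + b)\<^sup>2"
      using ord le by (intro power_mono) auto
    ultimately have "4 * (a * b + b * c + c * a) \<le> a * a + 2 * (a * b) + b * b"
      by (simp add: power2_eq_square algebra_simps)
    moreover have "b * b \<le> b * c" "a * a \<le> c * a" "0 < a * b" "0 < b * c" "0 < c * a"
      using a ord by (auto intro: mult_mono)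
    ultimately show False unfolding distrib_left by (simp add: mult.commute)
  qed
  moreover have "0 \<le> a + b" using pair_sum_nonneg_aux[OF D pos'] .
  ultimately show ?thesis
    unfolding sq root_quadruple_def descartes_quadruple_def
    using D pos' ord le by (simp add: entry_sum_4 sum_4 vector_4)
qed

text \<open>From here on the order of the tests is forgotten; only the fact that the replaced entry
  exceeds half of the sum is used.\<close>

lemma reduction_step_cases:
  obtains i where "entry_sum v / 2 < v $ i" "reduction_step (Current v) = Current (S i *v v)"
  | "\<And>i. v $ i \<le> entry_sum v / 2" "reduction_step (Current v) = Halted (sort_quadruple v)"
proof (cases "find (\<lambda>i. entry_sum (S i *v v) < entry_sum v) [1, 2, 3, 4]")
  case None
  then have "v $ i \<le> entry_sum v / 2" for i
    using exhaust_4[of i] by (auto simp: find_None_iff S_decreases_iff simp del: find.simps)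
  with None that(2) show ?thesis by (simp del: find.simps)
next
  case (Some i)
  then have "entry_sum v / 2 < v $ i"
    by (auto simp: find_Some_iff S_decreases_iff simp del: find.simps)
  with Some that(1) show ?thesis by (simp del: find.simps)
qed

section \<open>Runs of the algorithm that end at a root quadruple\<close>

definition reaches_root :: "real^4 \<Rightarrow> bool" where
  "reaches_root v \<longleftrightarrow> (\<exists>m w. reduction v m = Halted w \<and> root_quadruple w)"

lemma reduction_add:
  "reduction v n = Current u \<Longrightarrow> reduction v (n + m) = reduction u m"
  by (simp add: reduction_def funpow_add add.commute[of n])

lemma reduction_invariant:
  assumes "descartes_quadruple v" and "entry_sum v > 0" and "reduction v n = Current u"
  shows "descartes_quadruple u \<and> entry_sum u > 0"
  using assms(3)
proof (induction n arbitrary: u)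
  case 0
  then show ?case using assms(1,2) by (simp add: reduction_def)
next
  case (Suc n)
  have step: "reduction_step (reduction v n) = Current u"
    using Suc.prems by (simp add: reduction_def)
  then obtain w where w: "reduction v n = Current w" by (cases "reduction v n") auto
  with step have "reduction_step (Current w) = Current u" by simp
  then obtain i where "u = S i *v w" by (cases rule: reduction_step_cases[of w]) auto
  then show ?case
    using Suc.IH[OF w] descartes_quadruple_S entry_sum_S_pos by blast
qed

lemma reaches_root_step:
  assumes "reduction_step (Current v) = Current u" and "reaches_root u"
  shows "reaches_root v"
  using assms(2) reduction_add[of v 1 u] assms(1)
  unfolding reaches_root_def by (metis One_nat_def funpow_simps_right(1,2) comp_apply id_apply reduction_def)

lemma reaches_root_halt:
  assumes "descartes_quadruple v" and "entry_sum v > 0" and "\<And>i. v $ i \<le> entry_sum v / 2"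
    and "reduction_step (Current v) = Halted (sort_quadruple v)"
  shows "reaches_root v"
proof -
  have "reduction v 1 = Halted (sort_quadruple v)" using assms(4) by (simp add: reduction_def)
  then show ?thesis using root_quadruple_sort[OF assms(1-3)] unfolding reaches_root_def by blast
qed

text \<open>If \<open>m\<close> is the fourth index, the bracket is the pair sum at \<open>k\<close>
  and \<open>m\<close>. The bound comes from \<open>pair_product_ge_aux\<close>, whose other factor
  is at most the whole sum.\<close>

lemma pair_sum_lower_bound:
  assumes d: "descartes_quadruple v" and pos: "entry_sum v > 0"
    and ne: "i \<noteq> j" "i \<noteq> k" "j \<noteq> k"
  shows "(v $ k)\<^sup>2 \<le> (entry_sum v - v $ i - v $ j) * entry_sum v"
proof -
  obtain m where m: "m \<noteq> i" "m \<noteq> j" "m \<noteq> k" and U: "UNIV = {k, m, i, j}"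
  proof -
    have "card {k, i, j} < card (UNIV :: 4 set)" using ne by auto
    then obtain m where "m \<notin> {k, i, j}" by (metis UNIV_eq_I nat_neq_iff)
    moreover from this have "card {k, m, i, j} = card (UNIV :: 4 set)" using ne by auto
    then have "UNIV = {k, m, i, j}" by (metis card_subset_eq finite subset_UNIV)
    ultimately show ?thesis using that by auto
  qed
  have sum_U: "(\<Sum>x\<in>UNIV. f x) = f k + f m + f i + f j" for f :: "4 \<Rightarrow> real"
    unfolding U using m ne by simp
  have L: "entry_sum v = v $ k + v $ m + v $ i + v $ j"
    unfolding entry_sum_def by (rule sum_U)
  have "(v $ k)\<^sup>2 \<le> (v $ k + v $ m) * (v $ k + v $ i)"
    using d unfolding descartes_quadruple_def L sum_U by (rule pair_product_ge_aux)
  also have "\<dots> \<le> (v $ k + v $ m) * entry_sum v"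
  proof (rule mult_left_mono)
    show "v $ k + v $ i \<le> entry_sum v"
      using pair_sum_nonneg[OF d pos m(2)] L by simp
    show "0 \<le> v $ k + v $ m"
      using pair_sum_nonneg[OF d pos m(3)] by (simp add: add.commute)
  qed
  finally show ?thesis using L by (simp add: algebra_simps)
qed

text \<open>A negative entry \<open>a\<close> is never changed, because only an entry exceeding half of the sum is.
  A step that is followed by another one lowers the sum by over four times a pair sum \<open>a + v\<^sub>m\<close>, and these
  are bounded below by \<^term>\<open>a\<^sup>2\<close> divided by the sum.\<close>

lemma reaches_root_negative:
  assumes "descartes_quadruple v" and "entry_sum v > 0" and "v $ k < 0"
  shows "reaches_root v"
proof -
  define a where "a = v $ k"
  define \<delta> where "\<delta> = a\<^sup>2 / entry_sum v"
  have \<delta>: "\<delta> > 0" using assms by (simp add: \<delta>_def a_def)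
  \<comment> \<open>\<open>N\<close> counts how many drops by \<open>4 * \<delta>\<close> still fit
    into the sum. The fourth hypothesis keeps \<open>\<delta>\<close> a valid lower bound for pair
    sums while the sum shrinks.\<close>
  have *: "reaches_root u"
    if "descartes_quadruple u" "entry_sum u > 0" "u $ k = a"
      "entry_sum u * \<delta> \<le> a\<^sup>2" "entry_sum u \<le> real N * (4 * \<delta>)" for u N
    using that
  proof (induction N arbitrary: u)
    case 0
    then show ?case by simp
  next
    case (Suc N)
    have a: "a < 0" using assms by (simp add: a_def)
    let ?L = "entry_sum u"
    show ?case
    proof (cases rule: reduction_step_cases[of u])
      case 2
      then show ?thesis using reaches_root_halt Suc.prems(1,2) by blast
    next
      case (1 i)
      let ?w = "S i *v u"
      have w: "descartes_quadruple ?w" "entry_sum ?w > 0"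
        using descartes_quadruple_S entry_sum_S_pos Suc.prems by auto
      have ik: "i \<noteq> k" using 1 Suc.prems a by auto
      then have wk: "?w $ k = a" using Suc.prems by (simp add: S_component)
      have less: "entry_sum ?w < ?L" using 1 S_decreases_iff by blast
      have "reaches_root ?w"
      proof (cases rule: reduction_step_cases[of ?w])
        case 2
        then show ?thesis using reaches_root_halt w by blast
      next
        case (1 j)
        have jk: "j \<noteq> k" using 1 w wk a by auto
        \<comment> \<open>After \<open>S i\<close> the entry at \<open>i\<close> is below half of
          the new sum, so it is not replaced twice running.\<close>
        have ji: "i \<noteq> j"
          using 1(1) less by (auto simp: S_component entry_sum_S)
        have "?L * \<delta> \<le> (?L - u $ i - u $ j) * ?L"
          using pair_sum_lower_bound[OF Suc.prems(1,2) ji ik jk] Suc.prems(3,4) by simp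
        then have "\<delta> \<le> ?L - u $ i - u $ j"
          using Suc.prems(2) by (simp add: mult.commute)
        \<comment> \<open>The entry at \<open>j\<close> exceeds half of the new sum. With the bound
          on \<open>\<delta>\<close> this puts \<open>u $ i\<close> at least \<open>\<delta>\<close>
          above \<open>?L / 2\<close>, and the step lowers the sum by four times that
          excess.\<close>
        moreover have "3 * ?L - 4 * u $ i < 2 * u $ j"
          using 1(1) ji by (simp add: S_component entry_sum_S)
        ultimately have "entry_sum ?w \<le> ?L - 4 * \<delta>"
          by (simp add: entry_sum_S)
        then have "entry_sum ?w \<le> real N * (4 * \<delta>)"
          using Suc.prems(5) by (simp add: algebra_simps)
        moreover have "entry_sum ?w * \<delta> \<le> a\<^sup>2"
          using less \<delta> Suc.prems(4) by (meson less_eq_real_def mult_right_mono order_trans)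
        ultimately show ?thesis using Suc.IH w wk by blast
      qed
      then show ?thesis using 1(2) reaches_root_step by blast
    qed
  qed
  obtain N where "entry_sum v / (4 * \<delta>) \<le> real N"
    using real_arch_simple by blast
  then have "entry_sum v \<le> real N * (4 * \<delta>)"
    using \<delta> by (simp add: divide_le_eq)
  then show ?thesis using *[of v N] assms by (simp add: a_def \<delta>_def)
qed

text \<open>Integrality survives every step, so the sum is a positive integer that drops by at least
  1 with each replacement.\<close>

lemma reaches_root_integral:
  assumes "descartes_quadruple v" and "entry_sum v > 0" and "\<And>i. v $ i \<in> \<int>"
  shows "reaches_root v"
proof -
  have "reaches_root u"
    if "descartes_quadruple u" "entry_sum u > 0" "\<And>i. u $ i \<in> \<int>" "entry_sum u \<le> real N" for u N
    using that
  proof (induction N arbitrary: u)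
    case 0
    then show ?case by simp
  next
    case (Suc N)
    show ?case
    proof (cases rule: reduction_step_cases[of u])
      case 2
      then show ?thesis using reaches_root_halt Suc.prems(1,2) by blast
    next
      case (1 i)
      let ?w = "S i *v u"
      have w: "descartes_quadruple ?w" "entry_sum ?w > 0"
        using descartes_quadruple_S entry_sum_S_pos Suc.prems by auto
      have int: "entry_sum u \<in> \<int>" using Suc.prems(3) by (simp add: entry_sum_4)
      then have wint: "?w $ j \<in> \<int>" for j using Suc.prems(3) by (simp add: S_component)
      have "entry_sum ?w \<in> \<int>" using wint by (simp add: entry_sum_4)
      moreover have "entry_sum ?w < entry_sum u" using 1 S_decreases_iff by blast
      ultimately have "entry_sum ?w \<le> entry_sum u - 1"
        using int by (auto elim!: Ints_cases)
      then have "entry_sum ?w \<le> real N" using Suc.prems(4) by simp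
      then have "reaches_root ?w" using Suc.IH w wint by blast
      then show ?thesis using 1(2) reaches_root_step by blast
    qed
  qed
  moreover obtain N where "entry_sum v \<le> real N" using real_arch_simple by blast
  ultimately show ?thesis using assms by blast
qed


section \<open>Circles as vectors in Lorentz space\<close>

text \<open>The polar form of \<open>v $ 3 ^ 2 + v $ 4 ^ 2 - v $ 1 * v $ 2\<close>, which has
  signature (3,1).\<close>

definition lorentz :: "real^4 \<Rightarrow> real^4 \<Rightarrow> real" where
  "lorentz v w = v $ 3 * w $ 3 + v $ 4 * w $ 4 - (v $ 1 * w $ 2 + v $ 2 * w $ 1) / 2"

lemma lorentz_commute: "lorentz v w = lorentz w v"
  by (simp add: lorentz_def algebra_simps)

lemma lorentz_diff_right: "lorentz v (x - y) = lorentz v x - lorentz v y"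
  by (simp add: lorentz_def algebra_simps diff_divide_distrib add_divide_distrib)

lemma lorentz_add_right: "lorentz v (x + y) = lorentz v x + lorentz v y"
  by (simp add: lorentz_def algebra_simps diff_divide_distrib add_divide_distrib)

lemma lorentz_scale_right: "lorentz v (c *\<^sub>R x) = c * lorentz v x"
  by (simp add: lorentz_def algebra_simps diff_divide_distrib add_divide_distrib)

lemma lorentz_sum_right: "finite A \<Longrightarrow> lorentz v (\<Sum>k\<in>A. f k) = (\<Sum>k\<in>A. lorentz v (f k))"
  by (induction A rule: finite_induct) (simp_all add: lorentz_add_right, simp add: lorentz_def)

text \<open>Curvature, curvature of the image under inversion in the unit circle, and curvature times
  center; a line is a limit of circles.\<close>

fun circle_vector :: "oriented_circle \<Rightarrow> real^4" where
  "circle_vector (Circle c r) = vector [1 / r, ((cmod c)\<^sup>2 - r\<^sup>2) / r, Re c / r, Im c / r]"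
| "circle_vector (Line u t) = vector [0, 2 * t, Re u, Im u]"

lemma circle_vector_1: "circle_vector X $ 1 = curvature X"
  by (cases X) (simp_all add: vector_4)

lemma lorentz_circle_vector_self: "proper_circle X \<Longrightarrow> lorentz (circle_vector X) (circle_vector X) = 1"
proof (cases X)
  case (Circle c r)
  assume "proper_circle X"
  with Circle show ?thesis
    by (simp add: lorentz_def vector_4 cmod_power2) (simp add: field_simps power2_eq_square)
next
  case (Line u t)
  assume "proper_circle X"
  then have "(cmod u)\<^sup>2 = 1" using Line by simp
  then show ?thesis
    using Line by (simp add: lorentz_def vector_4 cmod_power2) (simp add: power2_eq_square)
qed

lemma circle_vector_inject:
  assumes "proper_circle X" and "proper_circle Y" and "circle_vector X = circle_vector Y"
  shows "X = Y"
proof -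
  have "circle_vector X $ i = circle_vector Y $ i" for i using assms by simp
  from this[of 1] this[of 2] this[of 3] this[of 4] show ?thesis
    using assms(1,2) by (cases X; cases Y) (auto simp: vector_4 complex_eq_iff)
qed

text \<open>The value is -1 iff the squared distance of the centers is \<open>(r + s)^2\<close>, and
  1 iff it is \<open>(r - s)^2\<close>. With signed radii, these are the two kinds of
  tangency.\<close>

lemma lorentz_circle_circle:
  assumes "r \<noteq> 0" and "s \<noteq> 0"
  shows "lorentz (circle_vector (Circle c r)) (circle_vector (Circle d s)) =
    (r\<^sup>2 + s\<^sup>2 - (cmod (c - d))\<^sup>2) / (2 * r * s)"
  using assms by (simp add: lorentz_def vector_4 cmod_power2) (simp add: field_simps power2_eq_square)

lemma lorentz_line_circle:
  assumes "r \<noteq> 0"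
  shows "lorentz (circle_vector (Line u t)) (circle_vector (Circle c r)) = (inner u c - t) / r"
  using assms by (simp add: lorentz_def vector_4 inner_complex_def field_simps)

lemma lorentz_line_line:
  "lorentz (circle_vector (Line u t)) (circle_vector (Line u' t')) = inner u u'"
  by (simp add: lorentz_def vector_4 inner_complex_def)

section \<open>Tangency with disjoint interiors as a Lorentz product of -1\<close>

text \<open>In the next two lemmas, reflecting a common point in the axis of symmetry of the two curves
  gives another common point; hence the only common point lies on the axis.\<close>

lemma unique_common_point_circles:
  assumes ex: "\<exists>!p. p \<in> sphere c a \<inter> sphere d b" and "a > 0" "b > 0"
  shows "(cmod (c - d))\<^sup>2 = (a + b)\<^sup>2 \<or> (cmod (c - d))\<^sup>2 = (a - b)\<^sup>2"
proof -
  from ex obtain p where p: "cmod (p - c) = a" "cmod (p - d) = b"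
    and uniq: "\<And>q. cmod (q - c) = a \<Longrightarrow> cmod (q - d) = b \<Longrightarrow> q = p"
    by (auto simp: dist_norm norm_minus_commute)
  define w z where "w = d - c" and "z = p - c"
  have w0: "w \<noteq> 0"
  proof
    assume "w = 0"
    then have "d = c" by (simp add: w_def)
    \<comment> \<open>On concentric circles the point opposite to \<open>p\<close> is common as
      well.\<close>
    then have "c - z = p"
      using p by (intro uniq) (auto simp: z_def norm_minus_commute)
    then have "2 * z = 0" by (simp add: z_def algebra_simps)
    then show False using p(1) \<open>a > 0\<close> by (simp add: z_def)
  qed
  \<comment> \<open>The map sending \<open>z\<close> to \<open>w * cnj z / cnj w\<close> is the
    reflection in the real line spanned by \<open>w\<close>, here the line through the two
    centers.\<close>
  define q where "q = c + w * cnj z / cnj w"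
  have "cmod (q - c) = cmod z"
    using w0 by (simp add: q_def norm_mult norm_divide)
  then have "cmod (q - c) = a" using p(1) by (simp add: z_def)
  moreover have "q - d = w * cnj (z - w) / cnj w"
    using w0 by (simp add: q_def w_def[symmetric] field_simps) (simp add: w_def algebra_simps)
  then have "cmod (q - d) = cmod (z - w)"
    using w0 by (simp only: norm_mult norm_divide complex_mod_cnj) simp
  then have "cmod (q - d) = b" using p(2) by (simp add: z_def w_def)
  ultimately have "q = p" by (rule uniq)
  then have "w * cnj z / cnj w = z" by (simp add: q_def z_def algebra_simps del: complex_cnj_diff)
  then have "w * cnj z = z * cnj w" using w0 by (auto simp: divide_eq_eq)
  then have "Im (w * cnj z) = Im (z * cnj w)" by simp
  then have par: "Im w * Re z = Re w * Im z" by simp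
  define \<rho> where "\<rho> = Re z * Re w + Im z * Im w"
  have "\<rho>\<^sup>2 + (Im w * Re z - Re w * Im z)\<^sup>2 = (cmod z)\<^sup>2 * (cmod w)\<^sup>2"
    unfolding cmod_power2 \<rho>_def by (simp add: power2_eq_square algebra_simps)
  then have "\<rho>\<^sup>2 = (a * cmod w)\<^sup>2" using par p(1) by (simp add: z_def power_mult_distrib)
  then have \<rho>: "\<rho> = a * cmod w \<or> \<rho> = - (a * cmod w)" by (simp add: power2_eq_iff)
  have "(cmod (z - w))\<^sup>2 = (cmod z)\<^sup>2 + (cmod w)\<^sup>2 - 2 * \<rho>"
    unfolding cmod_power2 \<rho>_def by (simp add: power2_eq_square algebra_simps)
  moreover have "cmod z = a" "cmod (z - w) = b" using p by (simp_all add: z_def w_def)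
  ultimately have "b\<^sup>2 = a\<^sup>2 + (cmod w)\<^sup>2 - 2 * \<rho>" by simp
  with \<rho> have "b\<^sup>2 = (cmod w - a)\<^sup>2 \<or> b\<^sup>2 = (cmod w + a)\<^sup>2"
    by (auto simp: power2_eq_square algebra_simps)
  then have "cmod w = a + b \<or> cmod w = a - b \<or> cmod w = b - a"
    unfolding power2_eq_iff using assms(2,3) norm_ge_zero[of w] by argo
  moreover have "cmod (c - d) = cmod w" by (simp add: w_def norm_minus_commute)
  moreover have "(b - a)\<^sup>2 = (a - b)\<^sup>2" by (rule power2_commute)
  ultimately show ?thesis by metis
qed

lemma unique_common_point_line_circle:
  assumes ex: "\<exists>!p. p \<in> sphere c a \<inter> {z. inner u z = t}" and u: "cmod u = 1"
  shows "(inner u c - t)\<^sup>2 = a\<^sup>2"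
proof -
  from ex obtain p where p: "cmod (p - c) = a" "inner u p = t"
    and uniq: "\<And>q. cmod (q - c) = a \<Longrightarrow> inner u q = t \<Longrightarrow> q = p"
    by (auto simp: dist_norm norm_minus_commute)
  define z where "z = p - c"
  \<comment> \<open>The mirror image of \<open>p\<close> in the perpendicular to the line through
    \<open>c\<close>; as \<open>u\<close> is a unit vector, the division by \<open>cnj u\<close>
    becomes a factor \<open>u\<close>.\<close>
  define q where "q = c + u * (u * cnj z)"
  have uu: "cnj u * u = 1"
    using u by (metis complex_norm_square mult.commute of_real_1 one_power2)
  have "Re (cnj u * (u * (u * cnj z))) = Re (u * cnj z)"
    using uu by (metis mult.assoc mult_1)
  then have "inner u (u * (u * cnj z)) = inner u z"
    by (simp add: inner_complex_def)
  then have "inner u q = t" using p(2) by (simp add: q_def z_def inner_add_right inner_diff_right)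
  moreover have "cmod (q - c) = cmod z"
    using u by (simp add: q_def norm_mult)
  then have "cmod (q - c) = a" using p(1) by (simp add: z_def)
  ultimately have "q = p" using uniq by blast
  then have "u * (u * cnj z) = z" by (simp add: q_def z_def algebra_simps del: complex_cnj_diff)
  then have "cnj u * z = u * cnj z"
    using uu by (metis mult.assoc mult_1)
  then have "Im (cnj u * z) = Im (u * cnj z)" by simp
  then have par: "Re u * Im z = Im u * Re z" by (simp add: mult.commute)
  have "(inner u z)\<^sup>2 + (Re u * Im z - Im u * Re z)\<^sup>2 = (cmod u)\<^sup>2 * (cmod z)\<^sup>2"
    unfolding cmod_power2 inner_complex_def by (simp add: power2_eq_square algebra_simps)
  then have "(inner u z)\<^sup>2 = a\<^sup>2" using par u p(1) by (simp add: z_def)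
  moreover have "inner u c - t = - inner u z" using p(2) by (simp add: z_def inner_diff_right)
  ultimately show ?thesis by simp
qed

text \<open>Far out along \<open>u\<close> one has left both discs and entered the half-plane. Hence
  two exteriors, or a half-plane and an exterior, are never disjoint.\<close>

lemma ex_large_norm_direction:
  assumes u: "cmod u = 1"
  shows "\<exists>z. inner u z > t \<and> cmod (z - c) > a \<and> cmod (z - d) > b"
proof -
  define l where "l = max (max (\<bar>t\<bar>) (cmod c + \<bar>a\<bar>)) (cmod d + \<bar>b\<bar>) + 1"
  define z where "z = of_real l * u"
  have l: "l > \<bar>t\<bar>" "l > cmod c + \<bar>a\<bar>" "l > cmod d + \<bar>b\<bar>" by (auto simp: l_def)
  have "inner u u = 1" using u by (simp add: dot_square_norm)
  moreover have "z = l *\<^sub>R u" by (simp add: z_def scaleR_conv_of_real)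
  ultimately have "inner u z = l" by simp
  moreover have "cmod z = l" using u l by (simp add: z_def norm_mult)
  moreover have "cmod (z - c) \<ge> cmod z - cmod c" "cmod (z - d) \<ge> cmod z - cmod d"
    by (rule norm_triangle_ineq2)+
  ultimately have "inner u z > t \<and> cmod (z - c) > a \<and> cmod (z - d) > b" using l by auto
  then show ?thesis by blast
qed

lemma unique_Some_iff: "(\<exists>!p. p \<in> Some ` A) \<longleftrightarrow> (\<exists>!p. p \<in> A)"
  by blast

text \<open>A unique common point leaves the squared distances \<open>(r + s)^2\<close> and
  \<open>(r - s)^2\<close>. The second makes the interiors overlap: at a center if some radius is
  positive, and far out if both are negative.\<close>

lemma lorentz_tangent_circles:
  assumes tan: "tangent (Circle c r) (Circle d s)"
    and disj: "circle_interior (Circle c r) \<inter> circle_interior (Circle d s) = {}"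
    and "r \<noteq> 0" "s \<noteq> 0"
  shows "lorentz (circle_vector (Circle c r)) (circle_vector (Circle d s)) = -1"
proof -
  have "Some ` sphere c \<bar>r\<bar> \<inter> Some ` sphere d \<bar>s\<bar> = Some ` (sphere c \<bar>r\<bar> \<inter> sphere d \<bar>s\<bar>)"
    by auto
  then have "\<exists>!p. p \<in> sphere c \<bar>r\<bar> \<inter> sphere d \<bar>s\<bar>"
    using tan by (simp only: tangent_def circle_points.simps unique_Some_iff)
  then have "(cmod (c - d))\<^sup>2 = (\<bar>r\<bar> + \<bar>s\<bar>)\<^sup>2 \<or> (cmod (c - d))\<^sup>2 = (\<bar>r\<bar> - \<bar>s\<bar>)\<^sup>2"
    using assms(3,4) by (intro unique_common_point_circles) auto
  then have "(cmod (c - d))\<^sup>2 = (r + s)\<^sup>2 \<or> (cmod (c - d))\<^sup>2 = (r - s)\<^sup>2"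
    by (auto simp: power2_eq_square algebra_simps abs_if split: if_splits)
  moreover have False if eq: "(cmod (c - d))\<^sup>2 = (r - s)\<^sup>2"
  proof -
    have D: "cmod (c - d) = \<bar>r - s\<bar>" using eq by (metis abs_norm_cancel power2_eq_iff abs_minus_cancel)
    have not: "z \<notin> circle_interior (Circle c r) \<or> z \<notin> circle_interior (Circle d s)" for z
      using disj by blast
    consider "r > 0" "s > 0" | "r > 0" "s < 0" | "r < 0" "s > 0" | "r < 0" "s < 0"
      using assms(3,4) by linarith
    then show False
    proof cases
      case 1
      then show False using D not[of c] not[of d]
        by (auto simp: dist_norm norm_minus_commute abs_if split: if_splits)
    next
      case 2
      then show False using D not[of c] by (auto simp: dist_norm norm_minus_commute)
    next
      case 3
      then show False using D not[of d] by (auto simp: dist_norm norm_minus_commute)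
    next
      case 4
      obtain z where "cmod (z - c) > \<bar>r\<bar>" "cmod (z - d) > \<bar>s\<bar>"
        using ex_large_norm_direction[of 1 0 "\<bar>r\<bar>" c "\<bar>s\<bar>" d] by auto
      then show False using 4 not[of z] by (auto simp: dist_norm norm_minus_commute)
    qed
  qed
  ultimately have "(cmod (c - d))\<^sup>2 = (r + s)\<^sup>2" by blast
  then show ?thesis
    using assms(3,4) unfolding lorentz_circle_circle[OF assms(3,4)]
    by (simp add: field_simps power2_eq_square)
qed

text \<open>The signed distance of the center from the line is \<open>r\<close> or
  \<open>-r\<close>. The value \<open>r\<close> gives overlap, at the center if \<open>r\<close> is
  positive and far out otherwise.\<close>

lemma lorentz_tangent_line_circle:
  assumes tan: "tangent (Line u t) (Circle c r)"
    and disj: "circle_interior (Line u t) \<inter> circle_interior (Circle c r) = {}"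
    and u: "cmod u = 1" and r: "r \<noteq> 0"
  shows "lorentz (circle_vector (Line u t)) (circle_vector (Circle c r)) = -1"
proof -
  have "insert None (Some ` {z. inner u z = t}) \<inter> Some ` sphere c \<bar>r\<bar> =
      Some ` (sphere c \<bar>r\<bar> \<inter> {z. inner u z = t})"
    by auto
  then have "\<exists>!p. p \<in> sphere c \<bar>r\<bar> \<inter> {z. inner u z = t}"
    using tan by (simp only: tangent_def circle_points.simps unique_Some_iff)
  then have "(inner u c - t)\<^sup>2 = r\<^sup>2"
    using unique_common_point_line_circle[OF _ u] by fastforce
  then have "inner u c - t = r \<or> inner u c - t = - r" by (simp add: power2_eq_iff)
  moreover have False if eq: "inner u c - t = r"
  proof (cases "r > 0")
    case True
    then show False using disj eq by (auto simp: disjoint_iff)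
  next
    case False
    obtain z where "inner u z > t" "cmod (z - c) > \<bar>r\<bar>"
      using ex_large_norm_direction[OF u] by blast
    then show False using False disj by (auto simp: disjoint_iff dist_norm norm_minus_commute)
  qed
  ultimately have "inner u c - t = - r" by blast
  then show ?thesis using r by (simp add: lorentz_line_circle del: circle_vector.simps)
qed

lemma lorentz_disjoint_lines:
  assumes disj: "circle_interior (Line u t) \<inter> circle_interior (Line u' t') = {}"
    and u: "cmod u = 1" "cmod u' = 1"
  shows "lorentz (circle_vector (Line u t)) (circle_vector (Line u' t')) = -1"
proof -
  have n: "inner u u = 1" "inner u' u' = 1" using u by (simp_all add: dot_square_norm)
  have "\<bar>inner u u'\<bar> \<le> 1" using Cauchy_Schwarz_ineq2[of u u'] u by simp
  moreover have "\<not> inner u u' > -1"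
  proof
    assume less: "inner u u' > -1"
    \<comment> \<open>Unless the normals are opposite, a large multiple of \<open>u + u'\<close>
      lies in both half-planes; the factor makes both inner products equal to the numerator.\<close>
    let ?l = "(\<bar>t\<bar> + \<bar>t'\<bar> + 1) / (1 + inner u u')"
    let ?z = "?l *\<^sub>R (u + u')"
    have "inner u ?z = ?l * (1 + inner u u')" "inner u' ?z = ?l * (1 + inner u u')"
      unfolding inner_scaleR_right inner_add_right n
      by (simp_all add: inner_commute add.commute)
    then have "inner u ?z = \<bar>t\<bar> + \<bar>t'\<bar> + 1" "inner u' ?z = \<bar>t\<bar> + \<bar>t'\<bar> + 1"
      using less by simp_all
    then have "inner u ?z > t" "inner u' ?z > t'" by linarith+
    then have "?z \<in> circle_interior (Line u t) \<inter> circle_interior (Line u' t')"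
      unfolding circle_interior.simps by blast
    then show False using disj by blast
  qed
  ultimately show ?thesis by (simp add: lorentz_line_line del: circle_vector.simps)
qed

lemma tangent_commute: "tangent X Y \<longleftrightarrow> tangent Y X"
  by (simp add: tangent_def Int_commute)

lemma lorentz_tangent:
  assumes "tangent X Y" and "circle_interior X \<inter> circle_interior Y = {}"
    and "proper_circle X" and "proper_circle Y"
  shows "lorentz (circle_vector X) (circle_vector Y) = -1"
proof (cases X; cases Y)
  fix c r d s assume "X = Circle c r" "Y = Circle d s"
  then show ?thesis using assms lorentz_tangent_circles by (metis proper_circle.simps(1))
next
  fix c r u t assume XY: "X = Circle c r" "Y = Line u t"
  then have "lorentz (circle_vector Y) (circle_vector X) = -1"
    using assms lorentz_tangent_line_circle[of u t c r, folded XY]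
    unfolding XY proper_circle.simps by (metis tangent_commute Int_commute)
  then show ?thesis by (simp add: lorentz_commute)
next
  fix c r u t assume XY: "Y = Circle c r" "X = Line u t"
  then show ?thesis using assms lorentz_tangent_line_circle[of u t c r] by simp
next
  fix u t u' t' assume "X = Line u t" "Y = Line u' t'"
  then show ?thesis using assms lorentz_disjoint_lines[of u t u' t'] by simp
qed


section \<open>Descartes configurations of vectors\<close>

definition lorentz_config :: "(4 \<Rightarrow> real^4) \<Rightarrow> bool" where
  "lorentz_config x \<longleftrightarrow> (\<forall>i j. lorentz (x i) (x j) = (if i = j then 1 else -1))"

text \<open>The Gram matrix \<open>G\<close> has 1 on and -1 off the diagonal, so
  \<open>G ** G\<close> is 4 times the identity and \<open>G / 4\<close> is its inverse. Applied to
  the products of \<open>y\<close> with the \<open>x i\<close> it gives the coefficients. That the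
  \<open>x i\<close> span follows since a right inverse of a square matrix is a left
  inverse.\<close>

lemma lorentz_config_expansion:
  assumes "lorentz_config x"
  shows "y = (\<Sum>i\<in>UNIV. (lorentz y (x i) / 2 - (\<Sum>j\<in>UNIV. lorentz y (x j)) / 4) *\<^sub>R x i)"
proof -
  define L :: "real^4 \<Rightarrow> real^4" where "L w = vector [- w $ 2 / 2, - w $ 1 / 2, w $ 3, w $ 4]" for w
  define X :: "real^4^4" where "X = (\<chi> i. x i)"
  (* H is the inverse of the Gram matrix of x, and B turns out to be the inverse of X *)
  define H :: "real^4^4" where "H = (\<chi> i j. if i = j then 1/4 else -1/4)"
  define B :: "real^4^4" where "B = (\<chi> k j. \<Sum>i\<in>UNIV. L (x i) $ k * H $ i $ j)"
  have lor: "lorentz v w = (\<Sum>k\<in>UNIV. v $ k * L w $ k)" for v w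
    by (simp add: lorentz_def L_def sum_4 vector_4 algebra_simps add_divide_distrib)
  have B: "(\<Sum>k\<in>UNIV. v $ k * B $ k $ j) = (\<Sum>i\<in>UNIV. lorentz v (x i) * H $ i $ j)" for v j
    unfolding B_def lor by (simp add: sum_distrib_left sum_distrib_right mult.assoc)
      (rule sum.swap)
  have "(X ** B) $ i $ j = (mat 1 :: real^4^4) $ i $ j" for i j
  proof -
    have "(X ** B) $ i $ j = (\<Sum>k\<in>UNIV. x i $ k * B $ k $ j)"
      by (simp add: matrix_matrix_mult_def X_def)
    also have "\<dots> = (\<Sum>k\<in>UNIV. (if i = k then 1 else -1) * H $ k $ j)"
      using assms by (simp add: B lorentz_config_def)
    also have "\<dots> = (mat 1 :: real^4^4) $ i $ j"
    proof -
      have "\<forall>i j. (\<Sum>k\<in>UNIV. (if i = k then 1 else -1) * H $ k $ j) = (mat 1 :: real^4^4) $ i $ j"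
        by (simp add: forall_4 sum_4 H_def mat_def)
      then show ?thesis by blast
    qed
    finally show ?thesis .
  qed
  then have "X ** B = mat 1" by (simp add: vec_eq_iff)
  then have BX: "B ** X = mat 1" by (simp add: matrix_left_right_inverse)
  have H: "(\<Sum>i\<in>UNIV. lorentz y (x i) * H $ i $ j) =
      lorentz y (x j) / 2 - (\<Sum>i\<in>UNIV. lorentz y (x i)) / 4" for j
    using exhaust_4[of j] by (auto simp: sum_4 H_def add_divide_distrib)
  have "y v* (B ** X) = (y v* B) v* X" by (simp add: vector_matrix_mul_assoc)
  then have "y = (y v* B) v* X" by (simp add: BX)
  also have "\<dots> = (\<Sum>i\<in>UNIV. (y v* B) $ i *\<^sub>R x i)"
    by (simp add: vec_eq_iff vector_matrix_mult_def X_def mult.commute)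
  also have "\<dots> = (\<Sum>i\<in>UNIV. (lorentz y (x i) / 2 - (\<Sum>j\<in>UNIV. lorentz y (x j)) / 4) *\<^sub>R x i)"
    unfolding vector_matrix_mult_def using B[of y] H by (simp add: mult.commute)
  finally show ?thesis .
qed

lemma lorentz_config_eqI:
  assumes "lorentz_config x" and "\<And>i. lorentz y (x i) = lorentz z (x i)"
  shows "y = z"
  using lorentz_config_expansion[OF assms(1), of y] lorentz_config_expansion[OF assms(1), of z]
  by (simp add: assms(2))

text \<open>Pairing \<open>y\<close> with its own expansion. In \<open>tangent_to_three\<close> this
  becomes a quadratic equation for the one unknown product.\<close>

lemma lorentz_config_norm:
  assumes "lorentz_config x"
  shows "lorentz y y = (\<Sum>i\<in>UNIV. (lorentz y (x i))\<^sup>2) / 2 - (\<Sum>i\<in>UNIV. lorentz y (x i))\<^sup>2 / 4"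
proof -
  let ?P = "\<Sum>j\<in>UNIV. lorentz y (x j)"
  have "lorentz y y = lorentz y (\<Sum>i\<in>UNIV. (lorentz y (x i) / 2 - ?P / 4) *\<^sub>R x i)"
    using arg_cong[OF lorentz_config_expansion[OF assms, of y], of "lorentz y"] .
  also have "\<dots> = (\<Sum>i\<in>UNIV. (lorentz y (x i))\<^sup>2) / 2 - ?P\<^sup>2 / 4"
    unfolding lorentz_sum_right[OF finite] lorentz_scale_right
    by (simp add: left_diff_distrib sum_subtractf power2_eq_square
        flip: sum_divide_distrib sum_distrib_left)
  finally show ?thesis .
qed

text \<open>The last hypothesis says that no \<open>S i\<close> decreases the sum of the curvatures; the one before
  holds for a circle whose interior is disjoint from the four interiors.\<close>

lemma curvature_ge_half_sum:
  assumes "lorentz_config x" and "\<And>i. lorentz y (x i) \<le> -1"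
    and "\<And>i. x i $ 1 \<le> (\<Sum>j\<in>UNIV. x j $ 1) / 2"
  shows "y $ 1 \<ge> (\<Sum>j\<in>UNIV. x j $ 1) / 2"
proof -
  let ?p = "\<lambda>i. lorentz y (x i)" and ?L = "\<Sum>j\<in>UNIV. x j $ 1"
  \<comment> \<open>The expansion of \<open>y $ 1\<close> regroups into a sum of
    \<open>- ?p i\<close> with the nonnegative weights \<open>(?L / 2 - x i $ 1) / 2\<close>. These
    add up to \<open>?L / 2\<close>, and every \<open>- ?p i\<close> is at least 1.\<close>
  have "?L / 2 = (\<Sum>i\<in>UNIV. (?L / 2 - x i $ 1) / 2)"
    by (simp add: sum_subtractf flip: sum_divide_distrib)
  also have "\<dots> \<le> (\<Sum>i\<in>UNIV. - ?p i * (?L / 2 - x i $ 1) / 2)"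
  proof (rule sum_mono)
    fix i
    have "1 * (?L / 2 - x i $ 1) \<le> - ?p i * (?L / 2 - x i $ 1)"
      using assms(2)[of i] assms(3)[of i] by (intro mult_right_mono) auto
    then show "(?L / 2 - x i $ 1) / 2 \<le> - ?p i * (?L / 2 - x i $ 1) / 2" by simp
  qed
  also have "\<dots> = (\<Sum>i\<in>UNIV. (?p i / 2 - (\<Sum>j\<in>UNIV. ?p j) / 4) * x i $ 1)"
    by (simp add: sum_4 algebra_simps add_divide_distrib diff_divide_distrib)
  also have "\<dots> = y $ 1"
    using arg_cong[OF lorentz_config_expansion[OF assms(1), of y], of "\<lambda>v. v $ 1"] by simp
  finally show ?thesis .
qed

text \<open>The same linear rule as \<open>S i\<close>, applied to whole circle vectors: it
  exchanges \<open>x i\<close> for the other unit vector tangent to the remaining three.\<close>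

definition invert_at :: "4 \<Rightarrow> (4 \<Rightarrow> real^4) \<Rightarrow> 4 \<Rightarrow> real^4" where
  "invert_at i x = x(i := 2 *\<^sub>R (\<Sum>k\<in>UNIV - {i}. x k) - x i)"

lemma invert_at_other [simp]: "k \<noteq> i \<Longrightarrow> invert_at i x k = x k"
  by (simp add: invert_at_def)

lemma lorentz_invert_at:
  "lorentz z (invert_at i x i) = 2 * (\<Sum>k\<in>UNIV - {i}. lorentz z (x k)) - lorentz z (x i)"
  by (simp add: invert_at_def lorentz_diff_right lorentz_scale_right lorentz_sum_right)

lemma invert_at_invert_at [simp]: "invert_at i (invert_at i x) = x"
proof -
  have "(\<Sum>k\<in>UNIV - {i}. invert_at i x k) = (\<Sum>k\<in>UNIV - {i}. x k)"
    by (rule sum.cong) auto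
  then show ?thesis by (auto simp: invert_at_def fun_eq_iff)
qed

lemma lorentz_invert_at_config:
  assumes "lorentz_config x"
  shows "lorentz (x j) (invert_at i x i) = (if j = i then -7 else -1)"
  using assms exhaust_4[of i] exhaust_4[of j]
  by (auto simp: lorentz_invert_at lorentz_config_def sum_diff1 sum_4)

lemma lorentz_config_invert_at:
  assumes "lorentz_config x"
  shows "lorentz_config (invert_at i x)"
proof -
  let ?z = "invert_at i x i"
  have "lorentz ?z (x k) = (if k = i then -7 else -1)" for k
    using lorentz_invert_at_config[OF assms] lorentz_commute by metis
  then have "lorentz ?z ?z = 1"
    using exhaust_4[of i] by (auto simp: lorentz_invert_at[of ?z] sum_diff1 sum_4)
  moreover have "lorentz (x j) ?z = -1" "lorentz ?z (x j) = -1" if "j \<noteq> i" for j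
    using lorentz_invert_at_config[OF assms, of j i] that by (auto simp: lorentz_commute)
  ultimately show ?thesis
    using assms unfolding lorentz_config_def by (metis invert_at_other)
qed

text \<open>With three products equal to -1 and norm 1, the fourth product \<open>p\<close>
  satisfies \<open>(p - 1) * (p + 7) = 0\<close>. Its roots belong to \<open>x d\<close> and to its
  inverted image, and the four products determine a vector.\<close>

lemma tangent_to_three:
  assumes x: "lorentz_config x" and "lorentz y y = 1" and "\<And>k. k \<noteq> d \<Longrightarrow> lorentz y (x k) = -1"
  shows "y = x d \<or> y = invert_at d x d"
proof -
  let ?p = "lorentz y (x d)"
  have sums: "(\<Sum>i\<in>UNIV. lorentz y (x i)) = ?p - 3" "(\<Sum>i\<in>UNIV. (lorentz y (x i))\<^sup>2) = ?p\<^sup>2 + 3"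
    using assms(3) exhaust_4[of d] by (auto simp: sum_4)
  have "(?p - 1) * (?p + 7) = 0"
    using lorentz_config_norm[OF x, of y] assms(2) unfolding sums
    by (simp add: power2_eq_square algebra_simps add_divide_distrib diff_divide_distrib)
  then consider "?p = 1" | "?p = -7" by auto
  then show ?thesis
  proof cases
    case 1
    then have "lorentz y (x k) = lorentz (x d) (x k)" for k
      using x assms(3) by (cases "k = d") (auto simp: lorentz_config_def)
    then show ?thesis using lorentz_config_eqI[OF x] by blast
  next
    case 2
    then have "lorentz y (x k) = lorentz (invert_at d x d) (x k)" for k
      using lorentz_invert_at_config[OF x, of k d] assms(3)[of k]
      by (cases "k = d") (auto simp: lorentz_commute)
    then show ?thesis using lorentz_config_eqI[OF x] by blast
  qed
qed


section \<open>Orbits of configurations\<close>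

inductive reachable :: "(4 \<Rightarrow> real^4) \<Rightarrow> (4 \<Rightarrow> real^4) \<Rightarrow> bool" for x where
  refl: "reachable x x"
| invert: "reachable x y \<Longrightarrow> reachable x (invert_at i y)"

lemma reachable_trans: "reachable y z \<Longrightarrow> reachable x y \<Longrightarrow> reachable x z"
  by (induction rule: reachable.induct) (auto intro: reachable.intros)

lemma reachable_sym: "reachable x y \<Longrightarrow> reachable y x"
proof (induction rule: reachable.induct)
  case refl
  show ?case by (rule reachable.refl)
next
  case (invert y i)
  have "reachable (invert_at i y) (invert_at i (invert_at i y))"
    by (intro reachable.intros)
  then show ?case using invert.IH reachable_trans by simp
qed

lemma lorentz_config_reachable: "reachable x y \<Longrightarrow> lorentz_config x \<Longrightarrow> lorentz_config y"
  by (induction rule: reachable.induct) (auto intro: lorentz_config_invert_at)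

text \<open>Words in the inversions without equal neighbors; the index argument records the last
  letter.\<close>

inductive reduced_path :: "(4 \<Rightarrow> real^4) \<Rightarrow> 4 \<Rightarrow> (4 \<Rightarrow> real^4) \<Rightarrow> bool" for x where
  single: "reduced_path x i (invert_at i x)"
| snoc: "reduced_path x j y \<Longrightarrow> i \<noteq> j \<Longrightarrow> reduced_path x i (invert_at i y)"

text \<open>Inversions are involutions, so repeating the last letter cancels it.\<close>

lemma reachable_reduced_path: "reachable x y \<Longrightarrow> y = x \<or> (\<exists>i. reduced_path x i y)"
proof (induction rule: reachable.induct)
  case refl
  then show ?case by simp
next
  case (invert y i)
  from invert.IH show ?case
  proof
    assume "y = x"
    then show ?thesis by (auto intro: reduced_path.single)
  next
    assume "\<exists>j. reduced_path x j y"
    then obtain j where j: "reduced_path x j y" by blast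
    show ?thesis
    proof (cases "i = j")
      case False
      then show ?thesis using j by (auto intro: reduced_path.snoc)
    next
      case True
      from j show ?thesis using True by cases auto
    qed
  qed
qed

lemma reduced_path_reachable: "reduced_path x i y \<Longrightarrow> reachable x y"
  by (induction rule: reduced_path.induct) (auto intro: reachable.intros)

text \<open>The invariant of a reduced path, ending with the inversion \<open>i\<close>, from the moment when \<open>z\<close> has
  left the configuration.\<close>

definition separated :: "real^4 \<Rightarrow> 4 \<Rightarrow> (4 \<Rightarrow> real^4) \<Rightarrow> bool" where
  "separated z i y \<longleftrightarrow> (\<forall>k. lorentz z (y k) \<le> -1) \<and>
     lorentz z (y i) \<le> (\<Sum>k\<in>UNIV - {i}. lorentz z (y k))"

text \<open>The start of the invariant: the products are -7 at \<open>i\<close> and -1 at the other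
  three indices.\<close>

lemma separated_invert_self:
  assumes "lorentz_config y"
  shows "separated (y i) i (invert_at i y)"
  unfolding separated_def
proof (intro conjI allI)
  have p: "lorentz (y i) (invert_at i y k) = (if k = i then -7 else -1)" for k
    using assms lorentz_invert_at_config[OF assms, of i i]
    by (cases "k = i") (auto simp: lorentz_config_def)
  show "lorentz (y i) (invert_at i y k) \<le> -1" for k by (simp add: p)
  show "lorentz (y i) (invert_at i y i) \<le> (\<Sum>k\<in>UNIV - {i}. lorentz (y i) (invert_at i y k))"
    unfolding p using exhaust_4[of i] by (auto simp: sum_diff1 sum_4)
qed

text \<open>Let \<open>s\<close> be the sum of the products at the indices other than
  \<open>j\<close>. The inequality at \<open>i\<close> gives \<open>s \<le> p - 4\<close> for the
  product \<open>p\<close> at \<open>j\<close>, so the new product \<open>2 * s - p\<close> is at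
  most \<open>s - 4\<close>, which is at most -7.\<close>

lemma separated_invert:
  assumes "separated z i y" and "j \<noteq> i"
  shows "separated z j (invert_at j y) \<and> lorentz z (invert_at j y j) < -1"
proof -
  let ?p = "\<lambda>k. lorentz z (y k)" and ?s = "\<Sum>k\<in>UNIV - {j}. lorentz z (y k)"
  have le: "?p k \<le> -1" for k using assms by (simp add: separated_def)
  have s: "?s \<le> ?p j - 4" "?s \<le> -3"
  proof -
    have "?p i \<le> (\<Sum>k\<in>UNIV - {i}. ?p k)" using assms(1) by (simp add: separated_def)
    then show "?s \<le> ?p j - 4" "?s \<le> -3"
      using assms(2) le[of 1] le[of 2] le[of 3] le[of 4] exhaust_4[of i] exhaust_4[of j]
      by (auto simp: sum_diff1 sum_4)
  qed
  have same: "(\<Sum>k\<in>UNIV - {j}. lorentz z (invert_at j y k)) = ?s"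
    by (rule sum.cong) auto
  have "lorentz z (invert_at j y k) \<le> -1" for k
    using s le[of k] by (cases "k = j") (auto simp: lorentz_invert_at)
  then show ?thesis
    unfolding separated_def same using s by (simp add: lorentz_invert_at)
qed

text \<open>Until the word inverts at \<open>t\<close>, the vector \<open>x t\<close> stays in
  place. The first such inversion establishes \<open>separated\<close>, and the later letters
  preserve it.\<close>

lemma reduced_path_kept_or_separated:
  assumes "lorentz_config x" and "reduced_path x i y"
  shows "y t = x t \<or> separated (x t) i y"
  using assms(2)
proof (induction rule: reduced_path.induct)
  case (single i)
  then show ?case using separated_invert_self[OF assms(1)] by (cases "t = i") auto
next
  case (snoc j y i)
  have y: "lorentz_config y"
    using snoc.hyps(1) assms(1) reduced_path_reachable lorentz_config_reachable by blast
  from snoc.IH show ?case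
  proof
    assume "y t = x t"
    then show ?thesis using separated_invert_self[OF y, of i] by (cases "t = i") auto
  next
    assume "separated (x t) j y"
    then show ?thesis using separated_invert snoc.hyps(2) by blast
  qed
qed

lemma lorentz_le_reachable:
  assumes "lorentz_config x" and "reachable x y" and "x s \<noteq> y t"
  shows "lorentz (x s) (y t) \<le> -1"
  using reachable_reduced_path[OF assms(2)]
proof
  assume "y = x"
  then show ?thesis using assms by (auto simp: lorentz_config_def)
next
  assume "\<exists>i. reduced_path x i y"
  then obtain i where i: "reduced_path x i y" by blast
  have y: "lorentz_config y" using assms(1,2) lorentz_config_reachable by blast
  from reduced_path_kept_or_separated[OF assms(1) i, of s] show ?thesis
  proof
    assume "y s = x s"
    then show ?thesis using y assms(3) unfolding lorentz_config_def by (metis order_refl)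
  qed (simp add: separated_def)
qed

text \<open>A new circle along a reduced path either shares a configuration with all the circles
  \<open>x t\<close>, or arises after one of them has been left behind and then is not tangent to it.\<close>

lemma reachable_common_or_far:
  assumes "lorentz_config x" and "reachable x y"
  shows "(\<exists>u. reachable x u \<and> insert (y j) (x ` T) \<subseteq> range u) \<or>
    (\<exists>t\<in>T. lorentz (x t) (y j) < -1)"
  using reachable_reduced_path[OF assms(2)]
proof
  assume "y = x"
  then show ?thesis using reachable.refl by blast
next
  assume "\<exists>i. reduced_path x i y"
  then obtain i where "reduced_path x i y" by blast
  then show ?thesis
  proof (induction arbitrary: j rule: reduced_path.induct)
    case (single i)
    show ?case
    proof (cases "i \<in> T \<and> j = i")
      case True
      then have "lorentz (x i) (invert_at i x j) < -1"
        using lorentz_invert_at_config[OF assms(1), of i i] by simp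
      then show ?thesis using True by blast
    next
      case False
      show ?thesis
      proof (cases "j = i")
        case True
        then have "x ` T \<subseteq> range (invert_at i x)"
          using False by (metis (no_types, lifting) image_subsetI invert_at_other rangeI)
        then show ?thesis using reachable.refl reachable.invert by blast
      next
        case False
        then show ?thesis using reachable.refl by auto
      qed
    qed
  next
    case (snoc k y i)
    have r: "reachable x y" using snoc.hyps(1) by (rule reduced_path_reachable)
    have y: "lorentz_config y" using lorentz_config_reachable[OF r assms(1)] .
    show ?case
    proof (cases "j = i")
      case False
      then show ?thesis using snoc.IH by simp
    next
      case True
      \<comment> \<open>Before the last inversion, either some \<open>x t\<close> has already been
        left behind, or \<open>y\<close> still contains all of them.\<close>
      consider t where "t \<in> T" "separated (x t) k y" | "\<forall>t\<in>T. y t = x t"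
        using reduced_path_kept_or_separated[OF assms(1) snoc.hyps(1)] by blast
      then show ?thesis
      proof cases
        case 1
        then show ?thesis using separated_invert snoc.hyps(2) True by blast
      next
        case 2
        show ?thesis
        proof (cases "i \<in> T")
          case True
          then have "lorentz (x i) (invert_at i y i) < -1"
            using 2 lorentz_invert_at_config[OF y, of i i] by simp
          then show ?thesis using True \<open>j = i\<close> by blast
        next
          case False
          have "x t \<in> range (invert_at i y)" if "t \<in> T" for t
            using that False 2 invert_at_other[of t i y] by (metis rangeI)
          then show ?thesis using r reachable.invert[of x y i] by blast
        qed
      qed
    qed
  qed
qed

text \<open>\<open>reachable_common_or_far\<close> is used twice: first to bring \<open>a\<close>
  and \<open>b\<close> into one configuration, then to add \<open>c\<close>. Tangency excludes the
  far alternative.\<close>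

lemma reachable_three_tangent:
  assumes x: "lorentz_config x"
    and reach: "reachable x u1" "reachable x u2" "reachable x u3"
    and mem: "a \<in> range u1" "b \<in> range u2" "c \<in> range u3"
    and tan: "lorentz a b = -1" "lorentz a c = -1" "lorentz b c = -1"
  shows "\<exists>u. reachable x u \<and> {a, b, c} \<subseteq> range u"
proof -
  have config: "lorentz_config u" if "reachable x u" for u
    using that x lorentz_config_reachable by blast
  obtain i j k where ijk: "a = u1 i" "b = u2 j" "c = u3 k" using mem by blast
  have r12: "reachable u1 u2" using reach reachable_sym reachable_trans by blast
  obtain u where u: "reachable u1 u" "{a, b} \<subseteq> range u"
    using reachable_common_or_far[OF config[OF reach(1)] r12, of j "{i}"] tan ijk by auto
  have xu: "reachable x u" using u(1) reach(1) by (rule reachable_trans)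
  have r23: "reachable u u3" using reach(3) xu reachable_sym reachable_trans by blast
  obtain i' j' where ij: "a = u i'" "b = u j'" using u(2) by blast
  obtain w where "reachable u w" "{a, b, c} \<subseteq> range w"
    using reachable_common_or_far[OF config[OF xu] r23, of k "{i', j'}"] tan ij ijk by auto
  then show ?thesis using xu reachable_trans by blast
qed


section \<open>Circles of a packing\<close>

lemma descartes_configuration_lorentz:
  assumes "descartes_configuration K" and "X \<in> K" and "Y \<in> K"
  shows "lorentz (circle_vector X) (circle_vector Y) = (if X = Y then 1 else -1)"
  using assms lorentz_circle_vector_self lorentz_tangent
  unfolding descartes_configuration_def pairwise_def by (cases "X = Y") auto

lemma descartes_configuration_lorentz_config:
  assumes "descartes_configuration K" and "bij_betw X UNIV K"
  shows "lorentz_config (circle_vector \<circ> X)"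
  unfolding lorentz_config_def
proof (intro allI)
  fix i j
  have "X i \<in> K" "X j \<in> K" using assms(2) by (auto simp: bij_betw_def)
  moreover have "X i = X j \<longleftrightarrow> i = j" using assms(2) by (auto simp: bij_betw_def inj_def)
  ultimately show "lorentz ((circle_vector \<circ> X) i) ((circle_vector \<circ> X) j) = (if i = j then 1 else -1)"
    using descartes_configuration_lorentz[OF assms(1)] by simp
qed

lemma descartes_configuration_enumeration:
  assumes "descartes_configuration K"
  obtains X :: "4 \<Rightarrow> oriented_circle" where "bij_betw X UNIV K"
proof -
  have "card K = 4" using assms by (simp add: descartes_configuration_def)
  then have "finite K" "card (UNIV :: 4 set) = card K" using card.infinite by fastforce+
  then show ?thesis using that finite_same_card_bij[of "UNIV :: 4 set" K] by auto
qed

text \<open>Geometric filling never leaves the orbit of the initial configuration: three mutually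
  tangent circles share a configuration of the orbit, and by \<open>tangent_to_three\<close> the
  filling circle is its fourth member or the inverted image of that member.\<close>

lemma packing_from_reachable:
  assumes K: "descartes_configuration K" and X: "bij_betw X UNIV K" and "Y \<in> packing_from K"
  shows "proper_circle Y \<and> (\<exists>u. reachable (circle_vector \<circ> X) u \<and> circle_vector Y \<in> range u)"
  using assms(3)
proof (induction rule: packing_from.induct)
  case (initial Y)
  then have "circle_vector Y \<in> range (circle_vector \<circ> X)"
    using X by (auto simp: bij_betw_def)
  then show ?case
    using initial K reachable.refl unfolding descartes_configuration_def by blast
next
  case (fill A B C D)
  let ?x = "circle_vector \<circ> X" and ?v = circle_vector
  note x = descartes_configuration_lorentz_config[OF K X]
  have D: "proper_circle D" using fill.hyps(4) by (simp add: descartes_configuration_def)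
  have "card {A, B, C, D} = 4" using fill.hyps(4) by (simp add: descartes_configuration_def)
  then have ne: "A \<noteq> B" "A \<noteq> C" "A \<noteq> D" "B \<noteq> C" "B \<noteq> D" "C \<noteq> D"
    by (auto simp: card_insert_if split: if_splits)
  note lor = descartes_configuration_lorentz[OF fill.hyps(4)]
  obtain u where u: "reachable ?x u" "{?v A, ?v B, ?v C} \<subseteq> range u"
  proof -
    have "lorentz (?v A) (?v B) = -1" "lorentz (?v A) (?v C) = -1" "lorentz (?v B) (?v C) = -1"
      using ne by (simp_all add: lor)
    moreover from fill.IH obtain u1 u2 u3
      where "reachable ?x u1" "?v A \<in> range u1" "reachable ?x u2" "?v B \<in> range u2"
        "reachable ?x u3" "?v C \<in> range u3"
      by blast
    ultimately show thesis using reachable_three_tangent[OF x] that by blast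
  qed
  obtain a where a: "?v A = u a" using u(2) by auto
  obtain b where b: "?v B = u b" using u(2) by auto
  obtain c where c: "?v C = u c" using u(2) by auto
  note abc = a b c
  have cu: "lorentz_config u" using u(1) x by (rule lorentz_config_reachable)
  have "lorentz (u a) (u b) = -1" "lorentz (u a) (u c) = -1" "lorentz (u b) (u c) = -1"
    unfolding abc[symmetric] using ne by (simp_all add: lor)
  then have "a \<noteq> b" "a \<noteq> c" "b \<noteq> c" using cu unfolding lorentz_config_def by auto
  then have "card {a, b, c} = 3" by simp
  then have "card (UNIV - {a, b, c}) = 1" by (simp add: card_Diff_subset)
  then obtain d where d: "UNIV - {a, b, c} = {d}" by (rule card_1_singletonE)
  have "lorentz (?v D) (u k) = -1" if "k \<noteq> d" for k
  proof -
    have "k \<in> {a, b, c}" using d that by blast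
    moreover have "lorentz (?v D) (u a) = -1" "lorentz (?v D) (u b) = -1" "lorentz (?v D) (u c) = -1"
      unfolding abc[symmetric] using ne by (simp_all add: lor)
    ultimately show ?thesis by blast
  qed
  moreover have "lorentz (?v D) (?v D) = 1" using lor[of D D] by simp
  ultimately have "?v D = u d \<or> ?v D = invert_at d u d" using tangent_to_three[OF cu] by blast
  then show ?case
  proof
    assume "?v D = u d"
    then have "?v D \<in> range u" by simp
    then show ?thesis using D u(1) by blast
  next
    assume "?v D = invert_at d u d"
    then have "?v D \<in> range (invert_at d u)" by simp
    then show ?thesis using D reachable.invert[OF u(1)] by blast
  qed
qed

lemma packing_from_lorentz_le:
  assumes K: "descartes_configuration K" and "Y \<in> packing_from K" "Z \<in> packing_from K" "Y \<noteq> Z"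
  shows "lorentz (circle_vector Y) (circle_vector Z) \<le> -1"
proof -
  obtain X :: "4 \<Rightarrow> oriented_circle" where X: "bij_betw X UNIV K"
    using descartes_configuration_enumeration[OF K] .
  note x = descartes_configuration_lorentz_config[OF K X]
  from packing_from_reachable[OF K X] assms(2,3) obtain u w
    where u: "reachable (circle_vector \<circ> X) u" "circle_vector Y \<in> range u"
      and w: "reachable (circle_vector \<circ> X) w" "circle_vector Z \<in> range w"
      and YZ: "proper_circle Y" "proper_circle Z"
    by blast
  have "circle_vector Y \<noteq> circle_vector Z" using circle_vector_inject YZ assms(4) by blast
  \<comment> \<open>As reachability is symmetric, the word can start at a configuration containing
    \<open>Y\<close>.\<close>
  moreover have "reachable u w" using u(1) w(1) reachable_sym reachable_trans by blast
  moreover have "lorentz_config u" using u(1) x by (rule lorentz_config_reachable)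
  moreover obtain i where "circle_vector Y = u i" using u(2) by auto
  moreover obtain j where "circle_vector Z = w j" using w(2) by auto
  ultimately show ?thesis using lorentz_le_reachable by metis
qed


section \<open>Uniqueness of the root quadruple\<close>

lemma root_quadruple_le_half_sum: "root_quadruple v \<Longrightarrow> v $ i \<le> entry_sum v / 2"
  using exhaust_4[of i] by (auto simp: root_quadruple_def entry_sum_4)

text \<open>Half of the entry sum separates the two sides: no entry of a root quadruple exceeds it,
  and by \<open>curvature_ge_half_sum\<close> the curvature of \<open>Y\<close> is at least
  that.\<close>

lemma root_configuration_outer_curvature:
  assumes K: "descartes_configuration K" "curvature_quadruple K v" and v: "root_quadruple v"
    and P: "\<And>X. X \<in> K \<Longrightarrow> lorentz (circle_vector Y) (circle_vector X) \<le> -1"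
    and "X \<in> K"
  shows "curvature X \<le> curvature Y"
proof -
  obtain Z where Z: "bij_betw Z UNIV K" "v = (\<chi> i. curvature (Z i))"
    using K(2) by (auto simp: curvature_quadruple_def)
  let ?x = "circle_vector \<circ> Z"
  have ZK: "Z i \<in> K" for i using Z(1) by (auto simp: bij_betw_def)
  have vx: "?x i $ 1 = v $ i" for i by (simp add: Z(2) circle_vector_1)
  have "circle_vector Y $ 1 \<ge> (\<Sum>j\<in>UNIV. ?x j $ 1) / 2"
    using descartes_configuration_lorentz_config[OF K(1) Z(1)]
  proof (rule curvature_ge_half_sum)
    show "lorentz (circle_vector Y) (?x i) \<le> -1" for i using P ZK by simp
    show "?x i $ 1 \<le> (\<Sum>j\<in>UNIV. ?x j $ 1) / 2" for i
      unfolding vx using root_quadruple_le_half_sum[OF v] by (simp add: entry_sum_def)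
  qed
  then have "entry_sum v / 2 \<le> curvature Y"
    unfolding vx circle_vector_1 by (simp add: entry_sum_def)
  moreover obtain i where "X = Z i" using \<open>X \<in> K\<close> Z(1) by (auto simp: bij_betw_def)
  then have "curvature X = v $ i" by (simp add: Z(2))
  ultimately show ?thesis using root_quadruple_le_half_sum[OF v, of i] by simp
qed

text \<open>The enumeration behind a curvature quadruple is arbitrary; the multiset of curvatures is
  independent of it.\<close>

lemma curvature_quadruple_mset:
  assumes "curvature_quadruple K v"
  shows "image_mset curvature (mset_set K) = mset [v $ 1, v $ 2, v $ 3, v $ 4]"
proof -
  obtain Z where Z: "bij_betw Z UNIV K" "v = (\<chi> i. curvature (Z i))"
    using assms by (auto simp: curvature_quadruple_def)
  have "mset_set K = image_mset Z (mset_set UNIV)"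
    using Z(1) by (simp add: bij_betw_def image_mset_mset_set)
  moreover have "mset_set (UNIV :: 4 set) = {#1, 2, 3, 4#}"
    unfolding UNIV_4 by simp
  ultimately show ?thesis by (simp add: Z(2))
qed

lemma image_mset_const:
  assumes "\<And>x. x \<in># M \<Longrightarrow> f x = k"
  shows "image_mset f M = replicate_mset (size M) k"
  using assms by (induction M) auto

lemma root_quadruple_mset_unique:
  assumes "root_quadruple v" and "root_quadruple w"
    and m: "mset [v $ 1, v $ 2, v $ 3, v $ 4] = mset [w $ 1, w $ 2, w $ 3, w $ 4]"
  shows "v = w"
proof -
  have "sorted [v $ 1, v $ 2, v $ 3, v $ 4]" "sorted [w $ 1, w $ 2, w $ 3, w $ 4]"
    using assms(1,2) by (auto simp: root_quadruple_def)
  then have "[v $ 1, v $ 2, v $ 3, v $ 4] = [w $ 1, w $ 2, w $ 3, w $ 4]"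
    using m by (metis properties_for_sort)
  then show ?thesis by (simp add: vec_eq_iff forall_4)
qed

text \<open>All circles in the symmetric difference of two root configurations have the same curvature.\<close>

lemma root_quadruple_unique:
  assumes K0: "descartes_configuration K0"
    and K: "K \<subseteq> packing_from K0" "descartes_configuration K" "curvature_quadruple K v" "root_quadruple v"
    and K': "K' \<subseteq> packing_from K0" "descartes_configuration K'" "curvature_quadruple K' w" "root_quadruple w"
  shows "v = w"
proof -
  have fin: "finite K" "finite K'" and card: "card K = card K'"
    using K(2) K'(2) card.infinite by (fastforce simp: descartes_configuration_def)+
  \<comment> \<open>A circle of the packing outside \<open>K\<close> has product at most -1 with
    each member of \<open>K\<close>.\<close>
  have le1: "curvature X \<le> curvature Y" if "X \<in> K" "Y \<in> K' - K" for X Y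
    using that K K'(1) root_configuration_outer_curvature[OF K(2-4), of Y X]
      packing_from_lorentz_le[OF K0, of Y] by blast
  have le2: "curvature Y \<le> curvature X" if "Y \<in> K'" "X \<in> K - K'" for X Y
    using that K(1) K' root_configuration_outer_curvature[OF K'(2-4), of X Y]
      packing_from_lorentz_le[OF K0, of X] by blast
  have size: "card (K - K') = card (K' - K)"
    using fin card by (simp add: card_Diff_subset_Int Int_commute)
  have "image_mset curvature (mset_set (K - K')) = image_mset curvature (mset_set (K' - K))"
  proof (cases "K - K' = {}")
    case True
    then have "K' - K = {}" using size fin by (metis card_0_eq card.empty finite_Diff)
    with True show ?thesis by simp
  next
    case False
    then obtain X where X: "X \<in> K - K'" by blast
    have "card (K' - K) \<noteq> 0" using size X fin by (metis card_0_eq empty_iff finite_Diff)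
    then obtain Y where Y: "Y \<in> K' - K" by (metis card.empty ex_in_conv)
    have eq: "curvature Z = curvature Z'" if "Z \<in> K - K'" "Z' \<in> K' - K" for Z Z'
      using le1 le2 that by (metis DiffD1 order_antisym)
    have "image_mset curvature (mset_set (K - K')) = replicate_mset (card (K - K')) (curvature Y)"
      using eq[OF _ Y] image_mset_const[of "mset_set (K - K')" curvature] fin by simp
    moreover have "image_mset curvature (mset_set (K' - K)) = replicate_mset (card (K' - K)) (curvature Y)"
      using eq[OF X] eq[OF X Y] image_mset_const[of "mset_set (K' - K)" curvature] fin by simp
    ultimately show ?thesis using size by simp
  qed
  moreover have "mset_set A = mset_set (A \<inter> B) + mset_set (A - B)" if "finite A" for A B :: "oriented_circle set"
    using that by (metis Int_Diff_Un Int_Diff_disjoint finite_Diff finite_Int mset_set_Union)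
  ultimately have "image_mset curvature (mset_set K) = image_mset curvature (mset_set K')"
    using fin by (metis Int_commute image_mset_union)
  then show ?thesis
    unfolding curvature_quadruple_mset[OF K(3)] curvature_quadruple_mset[OF K'(3)]
    by (rule root_quadruple_mset_unique[OF K(4) K'(4)])
qed


section \<open>The strip packing\<close>

text \<open>The normals point away from the strip between the lines, so the half-planes are disjoint
  from each other and from the unit discs.\<close>

definition strip_configuration :: "real \<Rightarrow> oriented_circle set" where
  "strip_configuration m =
     {Line \<i> 1, Line (- \<i>) 1, Circle (of_real m) 1, Circle (of_real (m + 2)) 1}"

lemma Re_unit_circle_extremal:
  fixes m :: real
  assumes "cmod (z - of_real m) = 1" and "\<bar>Im z\<bar> = 1"
  shows "Re z = m"
proof -
  have "(cmod (z - of_real m))\<^sup>2 = 1" using assms(1) by simp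
  moreover have "(Im z)\<^sup>2 = 1" using assms(2) by (metis one_power2 power2_abs)
  ultimately show ?thesis by (simp add: cmod_power2)
qed

lemma tangent_strip_lines: "tangent (Line \<i> 1) (Line (- \<i>) 1)"
  \<comment> \<open>The lines are parallel and meet only at infinity.\<close>
  unfolding tangent_def by (rule ex1I[of _ None]) (auto simp: inner_complex_def)

text \<open>The sign \<open>s\<close> treats both boundary lines at once; the point of contact is
  \<open>Complex m s\<close>.\<close>

lemma tangent_line_unit_circle:
  assumes "\<bar>s\<bar> = 1"
  shows "tangent (Line (of_real s * \<i>) 1) (Circle (of_real m) 1)"
  unfolding tangent_def
proof (rule ex1I[of _ "Some (Complex m s)"])
  have "s * s = 1" using assms by (metis abs_mult_self_eq mult_1)
  moreover have "Complex m s = of_real m + of_real s * \<i>" by (simp add: complex_eq_iff)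
  then have "cmod (of_real m - Complex m s) = 1" using assms by (simp add: norm_mult)
  ultimately show "Some (Complex m s) \<in> circle_points (Line (of_real s * \<i>) 1) \<inter> circle_points (Circle (of_real m) 1)"
    by (auto simp: inner_complex_def dist_norm)
next
  fix p assume p: "p \<in> circle_points (Line (of_real s * \<i>) 1) \<inter> circle_points (Circle (of_real m) 1)"
  then obtain z where z: "p = Some z" "cmod (z - of_real m) = 1" "s * Im z = 1"
    by (auto simp: inner_complex_def dist_norm norm_minus_commute)
  have "s = 1 \<or> s = -1" using assms by linarith
  then have "Im z = s" using z(3) by auto
  then have "z = Complex m s" using Re_unit_circle_extremal[OF z(2)] assms by (simp add: complex_eq_iff)
  with z(1) show "p = Some (Complex m s)" by simp
qed

lemma tangent_unit_circles: "tangent (Circle (of_real m) 1) (Circle (of_real (m + 2)) 1)"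
  unfolding tangent_def
proof (rule ex1I[of _ "Some (of_real (m + 1))"])
  have "of_real (m + 1) \<in> sphere (of_real m :: complex) 1 \<inter> sphere (of_real (m + 2)) 1"
    unfolding mem_sphere Int_iff dist_of_real by (simp add: dist_real_def)
  then show "Some (of_real (m + 1)) \<in> circle_points (Circle (of_real m) 1) \<inter> circle_points (Circle (of_real (m + 2)) 1)"
    by auto
next
  fix p assume p: "p \<in> circle_points (Circle (of_real m) 1) \<inter> circle_points (Circle (of_real (m + 2)) 1)"
  then obtain z where z: "p = Some z" "cmod (z - of_real m) = 1" "cmod (z - of_real (m + 2)) = 1"
    by (auto simp: dist_norm norm_minus_commute)
  have "(cmod (z - of_real m))\<^sup>2 = 1" "(cmod (z - of_real (m + 2)))\<^sup>2 = 1" using z by simp_all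
  then have sq: "(Re z - m)\<^sup>2 + (Im z)\<^sup>2 = 1" "(Re z - (m + 2))\<^sup>2 + (Im z)\<^sup>2 = 1"
    by (simp_all add: cmod_power2)
  \<comment> \<open>Subtracting the two circle equations leaves a linear equation for
    \<open>Re z\<close>.\<close>
  then have re: "Re z = m + 1" by (simp add: power2_eq_square algebra_simps)
  then have "Im z = 0" using sq(1) by simp
  with re z(1) show "p = Some (of_real (m + 1))" by (simp add: complex_eq_iff)
qed

lemma strip_line_circle_disjoint:
  assumes "\<bar>s\<bar> = 1"
  shows "circle_interior (Line (of_real s * \<i>) 1) \<inter> circle_interior (Circle (of_real m) 1) = {}"
proof -
  have False if "s * Im z > 1" "cmod (z - of_real m) < 1" for z
  proof -
    have "s * Im z \<le> \<bar>s\<bar> * \<bar>Im z\<bar>" by (metis abs_ge_self abs_mult)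
    also have "\<dots> = \<bar>Im (z - of_real m)\<bar>" using assms by simp
    also have "\<dots> \<le> cmod (z - of_real m)" by (rule abs_Im_le_cmod)
    finally show False using that by simp
  qed
  then show ?thesis by (auto simp: inner_complex_def dist_norm norm_minus_commute)
qed

lemma descartes_configuration_strip: "descartes_configuration (strip_configuration m)"
proof -
  define R where "R X Y \<longleftrightarrow> tangent X Y \<and> circle_interior X \<inter> circle_interior Y = {}" for X Y
  let ?C = "\<lambda>m::real. Circle (of_real m) 1"
  have "card (strip_configuration m) = 4"
    by (simp add: strip_configuration_def complex_eq_iff)
  moreover have "\<forall>X\<in>strip_configuration m. proper_circle X"
    by (simp add: strip_configuration_def)
  moreover have "pairwise R (strip_configuration m)"
  proof -
    have sym: "R X Y \<Longrightarrow> R Y X" for X Y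
      using tangent_commute Int_commute unfolding R_def by blast
    have LC: "R (Line \<i> 1) (?C c)" "R (Line (- \<i>) 1) (?C c)" for c
      using tangent_line_unit_circle[of 1 c] tangent_line_unit_circle[of "-1" c]
        strip_line_circle_disjoint[of 1 c] strip_line_circle_disjoint[of "-1" c]
      by (simp_all add: R_def del: circle_interior.simps)
    have "z \<notin> ball (of_real m) 1 \<inter> ball (of_real (m + 2)) 1" for z :: complex
    proof
      assume "z \<in> ball (of_real m) 1 \<inter> ball (of_real (m + 2)) 1"
      then have "dist (of_real m) z < 1" "dist (of_real (m + 2)) z < 1" by simp_all
      then have "dist (of_real m) (of_real (m + 2) :: complex) < 2"
        using dist_triangle2[of "of_real m" "of_real (m + 2)" z] by linarith
      then show False by (simp only: dist_of_real) (simp add: dist_real_def)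
    qed
    then have CC: "R (?C m) (?C (m + 2))"
      using tangent_unit_circles by (auto simp: R_def)
    have LL: "R (Line \<i> 1) (Line (- \<i>) 1)"
      using tangent_strip_lines by (auto simp: R_def inner_complex_def)
    show ?thesis
      unfolding strip_configuration_def pairwise_insert
      using LL LC CC LL[THEN sym] LC[THEN sym] CC[THEN sym] by (auto simp del: of_real_add)
  qed
  ultimately show ?thesis by (simp add: descartes_configuration_def R_def[abs_def])
qed

lemma curvature_quadruple_strip: "curvature_quadruple (strip_configuration m) (vector [0, 0, 1, 1])"
proof -
  define X :: "4 \<Rightarrow> oriented_circle" where
    "X i = (if i = 1 then Line \<i> 1 else if i = 2 then Line (- \<i>) 1
      else if i = 3 then Circle (of_real m) 1 else Circle (of_real (m + 2)) 1)" for i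
  have "inj X"
    unfolding inj_def forall_4 by (simp add: X_def complex_eq_iff)
  moreover have "range X = strip_configuration m"
    unfolding UNIV_4 by (auto simp: X_def strip_configuration_def)
  moreover have "vector [0, 0, 1, 1] = (\<chi> i. curvature (X i))"
    unfolding vec_eq_iff forall_4 by (simp add: vector_4 X_def)
  ultimately show ?thesis unfolding curvature_quadruple_def bij_betw_def by blast
qed

lemma root_quadruple_strip: "root_quadruple (vector [0, 0, 1, 1])"
  by (simp add: root_quadruple_def descartes_quadruple_def entry_sum_4 sum_4 vector_4)

text \<open>The shift by -2 keeps both lines and turns the unit circle at 0 into the right-hand
  circle, so a single filling supplies the missing circle.\<close>

lemma strip_configuration_subset: "strip_configuration (-2) \<subseteq> packing_from (strip_configuration 0)"
proof -
  let ?P = "packing_from (strip_configuration 0)"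
  have in_P: "Line \<i> 1 \<in> ?P" "Line (- \<i>) 1 \<in> ?P" "Circle 0 1 \<in> ?P"
    by (auto intro: packing_from.initial simp: strip_configuration_def)
  have "strip_configuration (-2) = {Line \<i> 1, Line (- \<i>) 1, Circle 0 1, Circle (-2) 1}"
    by (auto simp: strip_configuration_def)
  then show ?thesis
    using in_P packing_from.fill[OF in_P, of "Circle (-2) 1"] descartes_configuration_strip[of "-2"]
    by simp
qed

lemma strip_configuration_neq: "strip_configuration 0 \<noteq> strip_configuration (-2)"
proof
  assume "strip_configuration 0 = strip_configuration (-2)"
  moreover have "Circle 2 1 \<in> strip_configuration 0" by (simp add: strip_configuration_def)
  ultimately have "Circle 2 1 \<in> strip_configuration (-2)" by simp
  then show False by (simp add: strip_configuration_def complex_eq_iff)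
qed

theorem theorem3p2:
  shows
    "(\<forall>v\<^sub>0 n v. descartes_quadruple v\<^sub>0 \<and> entry_sum v\<^sub>0 > 0 \<and>
        reduction v\<^sub>0 n = Current v \<and> (\<exists>i. v $ i < 0) \<longrightarrow>
        (\<exists>m w. reduction v\<^sub>0 (n + m) = Halted w \<and> root_quadruple w)) \<and>
     (\<forall>v\<^sub>0. descartes_quadruple v\<^sub>0 \<and> entry_sum v\<^sub>0 > 0 \<and> (\<forall>i. v\<^sub>0 $ i \<in> \<int>) \<longrightarrow>
        (\<exists>m w. reduction v\<^sub>0 m = Halted w \<and> root_quadruple w)) \<and>
     (\<forall>P K K' v w. apollonian_packing P \<and>
        K \<subseteq> P \<and> descartes_configuration K \<and> curvature_quadruple K v \<and> root_quadruple v \<and>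
        K' \<subseteq> P \<and> descartes_configuration K' \<and> curvature_quadruple K' w \<and> root_quadruple w \<longrightarrow>
        v = w) \<and>
     (\<exists>P K K' v. apollonian_packing P \<and> root_quadruple v \<and> K \<noteq> K' \<and>
        K \<subseteq> P \<and> descartes_configuration K \<and> curvature_quadruple K v \<and>
        K' \<subseteq> P \<and> descartes_configuration K' \<and> curvature_quadruple K' v)"
proof (intro conjI allI impI)
  fix v\<^sub>0 v :: "real^4" and n
  assume asm: "descartes_quadruple v\<^sub>0 \<and> entry_sum v\<^sub>0 > 0 \<and>
    reduction v\<^sub>0 n = Current v \<and> (\<exists>i. v $ i < 0)"
  then have "descartes_quadruple v \<and> entry_sum v > 0"
    using reduction_invariant by blast
  then have "reaches_root v" using asm reaches_root_negative by blast
  then show "\<exists>m w. reduction v\<^sub>0 (n + m) = Halted w \<and> root_quadruple w"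
    using asm reduction_add unfolding reaches_root_def by metis
next
  fix v\<^sub>0 :: "real^4"
  assume "descartes_quadruple v\<^sub>0 \<and> entry_sum v\<^sub>0 > 0 \<and> (\<forall>i. v\<^sub>0 $ i \<in> \<int>)"
  then show "\<exists>m w. reduction v\<^sub>0 m = Halted w \<and> root_quadruple w"
    using reaches_root_integral unfolding reaches_root_def by blast
next
  fix P K K' v w
  assume "apollonian_packing P \<and>
    K \<subseteq> P \<and> descartes_configuration K \<and> curvature_quadruple K v \<and> root_quadruple v \<and>
    K' \<subseteq> P \<and> descartes_configuration K' \<and> curvature_quadruple K' w \<and> root_quadruple w"
  then show "v = w"
    using root_quadruple_unique unfolding apollonian_packing_def by blast
next
  \<comment> \<open>Two neighboring configurations in the strip packing, with parameters 0 and -2,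
    share the root quadruple (0, 0, 1, 1).\<close>
  have "strip_configuration 0 \<subseteq> packing_from (strip_configuration 0)"
    by (auto intro: packing_from.initial)
  moreover have "apollonian_packing (packing_from (strip_configuration 0))"
    using descartes_configuration_strip unfolding apollonian_packing_def by blast
  ultimately show "\<exists>P K K' v. apollonian_packing P \<and> root_quadruple v \<and> K \<noteq> K' \<and>
        K \<subseteq> P \<and> descartes_configuration K \<and> curvature_quadruple K v \<and>
        K' \<subseteq> P \<and> descartes_configuration K' \<and> curvature_quadruple K' v"
    using strip_configuration_neq strip_configuration_subset descartes_configuration_strip
      curvature_quadruple_strip root_quadruple_strip by blast
qed

end
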